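(* Let $p\ge1$ be an integer, let $F:\mathbb{R}^m\to\mathcal{P}(\mathbb{R}^n)$ be a definable multifunction with closed values, let $a\in\mathrm{dom}\,F$, and let $K$ be a compact definable neighbourhood of $a$ with $K\subset\mathrm{dom}\,F$. (1) If $F$ is outer semi-continuous, then there exists a definable $\varphi\in\Phi_p$ such that $\mathrm{dist}_K(F(x),F(a))\ge\varphi(d(x,F_*(F(a))))$ for all $x\in K$, where $F_*(F(a))=\{x\in\mathbb{R}^m:F(a)\subset F(x)\}$. (2) If $F$ is inner semi-continuous, then there exists a definable $\varphi\in\Phi_p$ such that $\mathrm{dist}_K(F(x),F(a))\ge\varphi(d(x,F^*(F(a))))$ for all $x\in K$, where $F^*(F(a))=\{x\in\mathrm{dom}\,F:F(x)\subset F(a)\}$. (3) If $F$ is continuous, then there exists a definable $\varphi\in\Phi_p$ such that $\mathrm{dist}_K(F(x),F(a))\ge\varphi(d(x,F^{-1}(F(a))))$ for all $x\in K$, where $F^{-1}(F(a))=\{x\in\mathbb{R}^m:F(x)=F(a)\}$.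
   Context: Definable means definable in a fixed o-minimal structure on the real field $(\mathbb{R},+,\cdot)$. A multifunction is a map $F:\mathbb{R}^m\to\mathcal{P}(\mathbb{R}^n)$; its domain is $\mathrm{dom}\,F=\{x: F(x)\ne\emptyset\}$, and it is definable if its graph $\{(x,y): y\in F(x)\}$ is a definable set. For $b\in\overline{\mathrm{dom}\,F\setminus\{b\}}$: $\liminf_{x\to b}F(x)$ is the set of $y$ such that for every sequence $x_\nu\in\mathrm{dom}\,F\setminus\{b\}$ with $x_\nu\to b$ there are $y_\nu\in F(x_\nu)$ with $y_\nu\to y$; $\limsup_{x\to b}F(x)$ is the set of $y$ for which there exist a sequence $x_\nu\in\mathrm{dom}\,F\setminus\{b\}$, $x_\nu\to b$, and $y_\nu\in F(x_\nu)$ with $y_\nu\to y$. $F$ is outer semi-continuous if $\limsup_{x\to b}F(x)\subset F(b)$, inner semi-continuous if $\liminf_{x\to b}F(x)\supset F(b)$, continuous if $\liminf_{x\to b}F(x)=\limsup_{x\to b}F(x)=F(b)$, in each case for every $b\in\mathrm{dom}\,F$ (no condition at points $b$ isolated in $\mathrm{dom}\,F$). $d(x,S)$ is the Euclidean distance from $x$ to $S$; for non-empty compact sets, $\mathrm{dist}_H(A,B)=\max\{\max_{x\in A}d(x,B),\max_{x\in B}d(x,A)\}$. The metric $\mathrm{dist}_K$ on non-empty closed subsets of $\mathbb{R}^n$ (here the subscript $K$ is part of the name of the metric and unrelated to the set $K$) is defined as follows. Identify $\mathbb{R}^n$ with $R=\mathbb{R}^n\times\{-1\}\subset\mathbb{R}^{n+1}$,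 let $\mathbb{S}^n$ be the unit sphere in $\mathbb{R}^{n+1}$ with the Euclidean metric restricted from $\mathbb{R}^{n+1}$, let $P=(0,\dots,0,1)$, let $s:\mathbb{S}^n\setminus\{P\}\to R$, $s(x)=\left(\frac{-2x_1}{x_{n+1}-1},\dots,\frac{-2x_n}{x_{n+1}-1},-1\right)$ be the stereographic projection and $h=s^{-1}$. Then $\mathrm{dist}_K(S,T)=\mathrm{dist}_H(h(S)\cup\{P\},h(T)\cup\{P\})$. $\Phi_p$ is the set of all odd, increasing bijections $\phi:\mathbb{R}\to\mathbb{R}$ of class $\mathcal{C}^p$ with $\phi^{(k)}(0)=0$ for $k\in\{1,\dots,p\}$. *)

theory Defs
  imports "HOL-Analysis.Analysis"
begin

text \<open>
  Points of the \<open>n\<close>-th Cartesian power of the reals are represented by lists of length \<open>n\<close>,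
  and \<open>S n\<close> is the family of definable subsets of that power.  As in van den Dries, all
  singletons of reals are definable, i.e. definability is with parameters.  The order needs no
  axiom of its own because it is definable from the field operations.
\<close>

locale o_minimal_structure =
  fixes S :: "nat \<Rightarrow> real list set set"
  assumes length_mem: "A \<in> S n \<Longrightarrow> xs \<in> A \<Longrightarrow> length xs = n"
    and empty_mem: "{} \<in> S n"
    and compl_mem: "A \<in> S n \<Longrightarrow> {xs. length xs = n} - A \<in> S n"
    and union_mem: "A \<in> S n \<Longrightarrow> B \<in> S n \<Longrightarrow> A \<union> B \<in> S n"
    and times_left_mem: "A \<in> S n \<Longrightarrow> {x # xs | x xs. xs \<in> A} \<in> S (Suc n)"
    and times_right_mem: "A \<in> S n \<Longrightarrow> {xs @ [x] | x xs. xs \<in> A} \<in> S (Suc n)"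
    and diagonal_mem: "i < j \<Longrightarrow> j < n \<Longrightarrow> {xs. length xs = n \<and> xs ! i = xs ! j} \<in> S n"
    and projection_mem: "A \<in> S (Suc n) \<Longrightarrow> butlast ` A \<in> S n"
    and singleton_mem: "{[r]} \<in> S 1"
    and add_mem: "{[x, y, x + y] | x y. True} \<in> S 3"
    and mult_mem: "{[x, y, x * y] | x y. True} \<in> S 3"
    and o_minimal: "A \<in> S 1 \<Longrightarrow>
      \<exists>\<I>. finite \<I> \<and> (\<forall>I\<in>\<I>. is_interval I) \<and> {x. [x] \<in> A} = \<Union>\<I>"

text \<open>
  The coordinates of a vector are listed along a fixed enumeration of the index type.  Which one
  is chosen is irrelevant, as the axioms above make every \<open>S n\<close> invariant under permutations of
  the coordinates.
\<close>

definition index_list :: "'n::finite list" where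
  "index_list = (SOME l. distinct l \<and> set l = UNIV)"

definition coords :: "real ^ 'n \<Rightarrow> real list" where
  "coords x = map (\<lambda>i. x $ i) index_list"

definition definable_set :: "(nat \<Rightarrow> real list set set) \<Rightarrow> (real ^ 'n) set \<Rightarrow> bool" where
  "definable_set S A \<longleftrightarrow> coords ` A \<in> S CARD('n)"

definition definable_multifunction ::
    "(nat \<Rightarrow> real list set set) \<Rightarrow> (real ^ 'm \<Rightarrow> (real ^ 'n) set) \<Rightarrow> bool" where
  "definable_multifunction S F \<longleftrightarrow>
     {coords x @ coords y | x y. y \<in> F x} \<in> S (CARD('m) + CARD('n))"

definition definable_real_fun :: "(nat \<Rightarrow> real list set set) \<Rightarrow> (real \<Rightarrow> real) \<Rightarrow> bool" where
  "definable_real_fun S \<phi> \<longleftrightarrow> {[t, \<phi> t] | t. True} \<in> S 2"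

definition mdom :: "('a \<Rightarrow> 'b set) \<Rightarrow> 'a set" where
  "mdom F = {x. F x \<noteq> {}}"

definition mliminf ::
    "('a::topological_space \<Rightarrow> 'b::topological_space set) \<Rightarrow> 'a \<Rightarrow> 'b set" where
  "mliminf F b = {y. \<forall>x::nat \<Rightarrow> 'a. (\<forall>\<nu>. x \<nu> \<in> mdom F - {b}) \<longrightarrow> x \<longlonglongrightarrow> b \<longrightarrow>
     (\<exists>y'. (\<forall>\<nu>. y' \<nu> \<in> F (x \<nu>)) \<and> y' \<longlonglongrightarrow> y)}"

definition mlimsup ::
    "('a::topological_space \<Rightarrow> 'b::topological_space set) \<Rightarrow> 'a \<Rightarrow> 'b set" where
  "mlimsup F b = {y. \<exists>x::nat \<Rightarrow> 'a. (\<forall>\<nu>. x \<nu> \<in> mdom F - {b}) \<and> x \<longlonglongrightarrow> b \<and>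
     (\<exists>y'. (\<forall>\<nu>. y' \<nu> \<in> F (x \<nu>)) \<and> y' \<longlonglongrightarrow> y)}"

definition outer_semicontinuous ::
    "('a::topological_space \<Rightarrow> 'b::topological_space set) \<Rightarrow> bool" where
  "outer_semicontinuous F \<longleftrightarrow>
     (\<forall>b\<in>mdom F. b \<in> closure (mdom F - {b}) \<longrightarrow> mlimsup F b \<subseteq> F b)"

definition inner_semicontinuous ::
    "('a::topological_space \<Rightarrow> 'b::topological_space set) \<Rightarrow> bool" where
  "inner_semicontinuous F \<longleftrightarrow>
     (\<forall>b\<in>mdom F. b \<in> closure (mdom F - {b}) \<longrightarrow> F b \<subseteq> mliminf F b)"

definition continuous_multifunction ::
    "('a::topological_space \<Rightarrow> 'b::topological_space set) \<Rightarrow> bool" where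
  "continuous_multifunction F \<longleftrightarrow>
     (\<forall>b\<in>mdom F. b \<in> closure (mdom F - {b}) \<longrightarrow> mliminf F b = mlimsup F b \<and> mlimsup F b = F b)"

definition lower_preimage :: "('a \<Rightarrow> 'b set) \<Rightarrow> 'b set \<Rightarrow> 'a set" where
  "lower_preimage F B = {x. B \<subseteq> F x}"

definition upper_preimage :: "('a \<Rightarrow> 'b set) \<Rightarrow> 'b set \<Rightarrow> 'a set" where
  "upper_preimage F B = {x \<in> mdom F. F x \<subseteq> B}"

definition point_preimage :: "('a \<Rightarrow> 'b set) \<Rightarrow> 'b set \<Rightarrow> 'a set" where
  "point_preimage F B = {x. F x = B}"

text \<open>For non-empty compact sets the suprema are attained, so they are maxima.\<close>

definition dist_H :: "'a::metric_space set \<Rightarrow> 'a set \<Rightarrow> real" where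
  "dist_H A B = max (SUP x\<in>A. infdist x B) (SUP x\<in>B. infdist x A)"

text \<open>
  Euclidean space of dimension one more is modelled as \<open>(real ^ 'n) \<times> real\<close>, whose product norm is
  the Euclidean one; the second component is the last coordinate.
\<close>

definition north_pole :: "(real ^ 'n) \<times> real" where
  "north_pole = (0, 1)"

definition stereo :: "(real ^ 'n) \<times> real \<Rightarrow> (real ^ 'n) \<times> real" where
  "stereo x = ((-2 / (snd x - 1)) *\<^sub>R fst x, -1)"

definition stereo_inv :: "(real ^ 'n) \<times> real \<Rightarrow> (real ^ 'n) \<times> real" where
  "stereo_inv = inv_into (sphere 0 1 - {north_pole}) stereo"

definition dist_K :: "(real ^ 'n) set \<Rightarrow> (real ^ 'n) set \<Rightarrow> real" where
  "dist_K A B = dist_H (stereo_inv ` (A \<times> {-1}) \<union> {north_pole})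
                       (stereo_inv ` (B \<times> {-1}) \<union> {north_pole})"

definition of_class_C :: "nat \<Rightarrow> (real \<Rightarrow> real) \<Rightarrow> bool" where
  "of_class_C p \<phi> \<longleftrightarrow> (\<forall>k<p. \<forall>t. (deriv ^^ k) \<phi> field_differentiable (at t)) \<and>
     continuous_on UNIV ((deriv ^^ p) \<phi>)"

definition Phi :: "nat \<Rightarrow> (real \<Rightarrow> real) set" where
  "Phi p = {\<phi>. (\<forall>t. \<phi> (- t) = - \<phi> t) \<and> strict_mono \<phi> \<and> bij \<phi> \<and>
     of_class_C p \<phi> \<and> (\<forall>k\<in>{1..p}. (deriv ^^ k) \<phi> 0 = 0)}"

end

theory Submission
  imports Defs
begin

text \<open>
  Let \<open>Z\<close> be one of the three preimages and let \<open>\<psi> t\<close> be the infimum of \<open>dist\<^sub>K(F(x), F(a))\<close> over the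
  points \<open>x\<close> of \<open>K\<close> with \<open>d(x, Z) \<ge> t\<close>.  Semicontinuity shows that a limit of points \<open>x\<^sub>\<nu>\<close> of \<open>K\<close> with
  \<open>dist\<^sub>K(F(x\<^sub>\<nu>), F(a))\<close> tending to \<open>0\<close> lies in \<open>Z\<close>, so \<open>\<psi> > 0\<close> on the positive reals by compactness.
  The function \<open>t\<^sup>p\<^sup>+\<^sup>1 \<psi> t\<close> is definable, increasing and \<open>o(t\<^sup>p)\<close> at \<open>0\<close>.  A definable function of one
  variable is differentiable to the right of \<open>0\<close>, and \<open>\<phi> = o(t\<^sup>p)\<close> implies \<open>\<phi>' = o(t\<^sup>p\<^sup>-\<^sup>1)\<close> by
  o-minimality, so this function is \<open>C\<^sup>p\<close> near \<open>0\<close> with vanishing derivatives.  Substituting a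
  semialgebraic contraction of the line to a small interval and adding a term that vanishes on the
  relevant range produces an element of \<open>\<Phi>\<^sub>p\<close> below \<open>\<psi>\<close>.
\<close>

section \<open>Coding points as lists of coordinates\<close>

text \<open>The structure need not be polynomially bounded, so \<open>\<psi>\<close> may vanish
  faster than every power and no inequality with an exponent can be expected; the minorant has to be
  made out of \<open>\<psi>\<close> itself. Semicontinuity of \<open>F\<close> in only one sense
  does not make \<open>dist_K (F x) (F a)\<close> continuous in \<open>x\<close>, so no minimum over
  a compact set is available and positivity of \<open>\<psi>\<close> is argued along sequences. All
  regularity comes from definability. In place of the monotonicity theorem, two consequences of
  o-minimality suffice: a definable property of \<open>t\<close> holds throughout or fails
  throughout some interval to the right of a given point, and an infinite definable set of reals
  contains an interval. The first one lets a bound on a derivative be proved by excluding the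
  opposite strict inequality, before any limit is known to exist.\<close>

text \<open>
  Free variables of a formula are packed into one point of a product type.  With predicates on
  arbitrary coded types, quantifiers and substitutions need no bookkeeping of variables.
\<close>

class real_coded =
  fixes enc :: "'a \<Rightarrow> real list" and edim :: "'a itself \<Rightarrow> nat"
  assumes bij_enc: "bij_betw enc UNIV {xs. length xs = edim TYPE('a)}"

lemma length_enc [simp]: "length (enc (x :: 'a::real_coded)) = edim TYPE('a)"
  using bij_betwE[OF bij_enc] by auto

lemma enc_inject [simp]: "enc x = enc y \<longleftrightarrow> x = y"
  using bij_enc by (auto simp: bij_betw_def inj_on_def)

lemma enc_surj:
  assumes "length xs = edim TYPE('a)"
  obtains x :: "'a::real_coded" where "xs = enc x"
  using bij_betw_imp_surj_on[OF bij_enc] assms by (metis (mono_tags, lifting) imageE mem_Collect_eq)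

lemma enc_image_iff [simp]: "enc x \<in> enc ` A \<longleftrightarrow> x \<in> A"
  by auto

lemma enc_Collect:
  "{xs. length xs = edim TYPE('a) \<and> P xs} = enc ` {x :: 'a::real_coded. P (enc x)}"
proof (intro equalityI subsetI)
  fix xs assume xs: "xs \<in> {xs. length xs = edim TYPE('a) \<and> P xs}"
  then obtain x :: 'a where "xs = enc x" by (auto intro: enc_surj)
  then show "xs \<in> enc ` {x :: 'a. P (enc x)}" using xs by simp
qed auto

text \<open>
  A type-class instance for \<open>real ^ 'n\<close> must leave the component type variable, so a class whose
  intended instance is \<open>real\<close> restricts it.
\<close>

class real_like =
  fixes to_real :: "'a \<Rightarrow> real"
  assumes bij_to_real: "bij to_real"

instantiation real :: "{real_coded, real_like}"
begin

definition "enc (x :: real) = [x]"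
definition "edim (_ :: real itself) = (1 :: nat)"
definition "to_real (x :: real) = x"

instance
proof
  show "bij_betw (enc :: real \<Rightarrow> _) UNIV {xs. length xs = edim TYPE(real)}"
    by (auto simp: bij_betw_def inj_on_def enc_real_def edim_real_def length_Suc_conv)
  show "bij (to_real :: real \<Rightarrow> real)"
    unfolding to_real_real_def by (metis bij_id eq_id_iff)
qed

end

lemma index_list:
  "distinct (index_list :: 'n::finite list)" "set (index_list :: 'n list) = UNIV"
proof -
  have "\<exists>l :: 'n list. distinct l \<and> set l = UNIV"
    using finite_distinct_list[of "UNIV :: 'n set"] by auto
  then have "distinct (index_list :: 'n list) \<and> set (index_list :: 'n list) = UNIV"
    unfolding index_list_def by (rule someI_ex)
  then show "distinct (index_list :: 'n list)" "set (index_list :: 'n list) = UNIV" by auto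
qed

lemma length_index_list: "length (index_list :: 'n::finite list) = CARD('n)"
  using index_list distinct_card by metis

instantiation vec :: (real_like, finite) real_coded
begin

definition "enc (x :: 'a ^ 'b) = map (\<lambda>i. to_real (x $ i)) index_list"
definition "edim (_ :: ('a ^ 'b) itself) = CARD('b)"

instance
proof
  let ?l = "index_list :: 'b list"
  show "bij_betw (enc :: 'a ^ 'b \<Rightarrow> _) UNIV {xs. length xs = edim TYPE('a ^ 'b)}"
  proof (rule bij_betw_imageI)
    show "inj (enc :: 'a ^ 'b \<Rightarrow> _)"
      using bij_to_real[where 'a = 'a]
      by (auto simp: inj_on_def enc_vec_def index_list vec_eq_iff bij_def)
    show "range (enc :: 'a ^ 'b \<Rightarrow> _) = {xs. length xs = edim TYPE('a ^ 'b)}"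
    proof (intro equalityI subsetI)
      fix xs :: "real list" assume "xs \<in> {xs. length xs = edim TYPE('a ^ 'b)}"
      then have len: "length xs = CARD('b)" by (simp add: edim_vec_def)
      define x :: "'a ^ 'b" where
        "x = (\<chi> i. inv to_real (xs ! inv_into {..<CARD('b)} ((!) ?l) i))"
      have "inj_on ((!) ?l) {..<CARD('b)}"
        using inj_on_nth[OF index_list(1)[where 'n = 'b], of "{..<CARD('b)}"]
        by (simp add: length_index_list)
      then have "enc x = xs"
        using len bij_to_real[where 'a = 'a]
        by (intro nth_equalityI)
          (auto simp: enc_vec_def x_def length_index_list inv_into_f_f surj_f_inv_f bij_def)
      then show "xs \<in> range (enc :: 'a ^ 'b \<Rightarrow> _)" by (metis rangeI)
    qed (auto simp: enc_vec_def edim_vec_def length_index_list)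
  qed
qed

end

lemma enc_eq_coords: "enc = (coords :: real ^ 'n \<Rightarrow> _)"
  by (auto simp: enc_vec_def coords_def to_real_real_def)

instantiation prod :: (real_coded, real_coded) real_coded
begin

definition "enc (z :: 'a \<times> 'b) = enc (fst z) @ enc (snd z)"
definition "edim (_ :: ('a \<times> 'b) itself) = edim TYPE('a) + edim TYPE('b)"

instance
proof
  show "bij_betw (enc :: 'a \<times> 'b \<Rightarrow> _) UNIV {xs. length xs = edim TYPE('a \<times> 'b)}"
  proof (rule bij_betw_imageI)
    show "inj (enc :: 'a \<times> 'b \<Rightarrow> _)"
      by (auto simp: inj_on_def enc_prod_def)
    show "range (enc :: 'a \<times> 'b \<Rightarrow> _) = {xs. length xs = edim TYPE('a \<times> 'b)}"
    proof (intro equalityI subsetI)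
      fix xs :: "real list" assume "xs \<in> {xs. length xs = edim TYPE('a \<times> 'b)}"
      then have len: "length xs = edim TYPE('a) + edim TYPE('b)" by (simp add: edim_prod_def)
      obtain a :: 'a where a: "take (edim TYPE('a)) xs = enc a"
        using len by (auto intro: enc_surj[of "take (edim TYPE('a)) xs"])
      obtain b :: 'b where b: "drop (edim TYPE('a)) xs = enc b"
        using len by (auto intro: enc_surj[of "drop (edim TYPE('a)) xs"])
      have "xs = enc (a, b)"
        using a b by (metis append_take_drop_id enc_prod_def fst_conv snd_conv)
      then show "xs \<in> range (enc :: 'a \<times> 'b \<Rightarrow> _)" by blast
    qed (auto simp: enc_prod_def edim_prod_def)
  qed
qed

end

lemma enc_pair: "enc (x, y) = enc x @ enc y"
  by (simp add: enc_prod_def)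

section \<open>Definable predicates and functions\<close>

named_theorems definable_intros

context o_minimal_structure
begin

section \<open>Set operations and changes of coordinates\<close>

lemma full_mem: "{xs. length xs = n} \<in> S n"
  using compl_mem[OF empty_mem, of n] by simp

lemma inter_mem:
  assumes "A \<in> S n" "B \<in> S n"
  shows "A \<inter> B \<in> S n"
proof -
  let ?U = "{xs :: real list. length xs = n}"
  have "?U - ((?U - A) \<union> (?U - B)) \<in> S n"
    by (intro compl_mem union_mem assms)
  also have "?U - ((?U - A) \<union> (?U - B)) = A \<inter> B"
    using assms length_mem by blast
  finally show ?thesis .
qed

lemma finite_inter_mem:
  assumes "finite I" "\<And>i. i \<in> I \<Longrightarrow> {xs. length xs = n \<and> P i xs} \<in> S n"
  shows "{xs. length xs = n \<and> (\<forall>i\<in>I. P i xs)} \<in> S n"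
  using assms
proof (induction I rule: finite_induct)
  case empty
  then show ?case using full_mem by simp
next
  case (insert i I)
  have "{xs. length xs = n \<and> (\<forall>i\<in>insert i I. P i xs)} =
      {xs. length xs = n \<and> P i xs} \<inter> {xs. length xs = n \<and> (\<forall>i\<in>I. P i xs)}"
    by auto
  then show ?case using insert inter_mem by simp
qed

lemma eq_coord_mem:
  assumes "i < n" "j < n"
  shows "{xs. length xs = n \<and> xs ! i = xs ! j} \<in> S n"
proof (cases i j rule: linorder_cases)
  case less
  then show ?thesis using assms diagonal_mem by simp
next
  case equal
  then show ?thesis using full_mem by simp
next
  case greater
  then show ?thesis using assms diagonal_mem[of j i n] by (simp add: eq_commute)
qed

lemma append_left_mem:
  assumes "A \<in> S n"
  shows "{xs @ ys | xs ys. length xs = k \<and> ys \<in> A} \<in> S (k + n)"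
proof (induction k)
  case 0
  then show ?case using assms by simp
next
  case (Suc k)
  have "{xs @ ys | xs ys. length xs = Suc k \<and> ys \<in> A} =
      {x # zs | x zs. zs \<in> {xs @ ys | xs ys. length xs = k \<and> ys \<in> A}}"
    (is "?L = ?R")
  proof (intro equalityI subsetI)
    fix zs assume "zs \<in> ?L"
    then obtain xs ys where zs: "zs = xs @ ys" "length xs = Suc k" "ys \<in> A" by blast
    then obtain x xs' where "xs = x # xs'" "length xs' = k" by (auto simp: length_Suc_conv)
    then show "zs \<in> ?R" using zs by auto
  next
    fix zs assume "zs \<in> ?R"
    then obtain x xs ys where "zs = (x # xs) @ ys" "length xs = k" "ys \<in> A" by auto
    then show "zs \<in> ?L" by (metis (mono_tags, lifting) CollectI length_Cons)
  qed
  then show ?case using times_left_mem[OF Suc] by simp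
qed

lemma take_mem:
  assumes "A \<in> S (n + k)"
  shows "take n ` A \<in> S n"
  using assms
proof (induction k arbitrary: A)
  case 0
  then have "take n ` A = A"
    using length_mem[OF 0] by (auto simp: image_iff)
  then show ?case using 0 by simp
next
  case (Suc k)
  have "take n ` butlast ` A \<in> S n"
    using Suc projection_mem by simp
  also have "take n ` butlast ` A = take n ` A"
    unfolding image_image using length_mem[OF Suc.prems]
    by (intro image_cong) (auto simp: take_butlast)
  finally show ?case .
qed

text \<open>The tuple \<open>map ((!) xs) \<sigma>\<close> is adjoined as a block after
  \<open>xs\<close>, tied to it by diagonal equations and constrained to \<open>A\<close>;
  projecting the block away leaves the preimage. Permuting, repeating and forgetting coordinates are
  special cases.\<close>

lemma reindex_mem:
  assumes A: "A \<in> S k" and \<sigma>: "length \<sigma> = k" "set \<sigma> \<subseteq> {..<n}"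
  shows "{xs. length xs = n \<and> map ((!) xs) \<sigma> \<in> A} \<in> S n"
proof -
  let ?B = "{xs @ ys | xs ys. length xs = n \<and> ys \<in> A}"
  let ?E = "{zs. length zs = n + k \<and> (\<forall>j\<in>{..<k}. zs ! (\<sigma> ! j) = zs ! (n + j))}"
  have "?E \<in> S (n + k)"
  proof (intro finite_inter_mem eq_coord_mem)
    fix j assume "j \<in> {..<k}"
    then have "\<sigma> ! j < n" using \<sigma> by (metis lessThan_iff nth_mem subset_iff)
    then show "\<sigma> ! j < n + k" by simp
  qed auto
  then have "take n ` (?B \<inter> ?E) \<in> S n"
    using append_left_mem[OF A, of n] by (intro take_mem inter_mem)
  also have "take n ` (?B \<inter> ?E) = {xs. length xs = n \<and> map ((!) xs) \<sigma> \<in> A}"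
  proof (intro equalityI subsetI)
    fix xs assume "xs \<in> take n ` (?B \<inter> ?E)"
    then obtain ys where xs: "length xs = n" and ys: "ys \<in> A" and E: "xs @ ys \<in> ?E"
      by auto
    have "map ((!) xs) \<sigma> = ys"
    proof (rule nth_equalityI)
      show len: "length (map ((!) xs) \<sigma>) = length ys" using length_mem[OF A ys] \<sigma> by simp
      fix j assume "j < length (map ((!) xs) \<sigma>)"
      then have j: "j < k" using \<sigma> by simp
      then have "\<sigma> ! j < n" using \<sigma> by (metis lessThan_iff nth_mem subset_iff)
      moreover have "(xs @ ys) ! (\<sigma> ! j) = (xs @ ys) ! (n + j)" using E j by simp
      ultimately show "map ((!) xs) \<sigma> ! j = ys ! j"
        using j xs \<sigma> by (simp add: nth_append)
    qed
    then show "xs \<in> {xs. length xs = n \<and> map ((!) xs) \<sigma> \<in> A}" using xs ys by simp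
  next
    fix xs assume "xs \<in> {xs. length xs = n \<and> map ((!) xs) \<sigma> \<in> A}"
    then have xs: "length xs = n" "map ((!) xs) \<sigma> \<in> A" by auto
    have "xs @ map ((!) xs) \<sigma> \<in> ?E"
    proof -
      have "\<sigma> ! j < n" if "j < k" for j
        using that \<sigma> by (metis lessThan_iff nth_mem subset_iff)
      then show ?thesis using xs \<sigma> by (auto simp: nth_append)
    qed
    then have "xs @ map ((!) xs) \<sigma> \<in> ?B \<inter> ?E" using xs by blast
    then show "xs \<in> take n ` (?B \<inter> ?E)"
      by (rule image_eqI[rotated]) (simp add: xs(1))
  qed
  finally show ?thesis .
qed

section \<open>First-order definability of predicates and maps\<close>

definition definable :: "('e::real_coded \<Rightarrow> bool) \<Rightarrow> bool" where
  "definable P \<longleftrightarrow> enc ` {e. P e} \<in> S (edim TYPE('e))"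

definition definable_fun :: "('e::real_coded \<Rightarrow> 'a::real_coded) \<Rightarrow> bool" where
  "definable_fun f \<longleftrightarrow> definable (\<lambda>z. snd z = f (fst z))"

lemma definable_conj [definable_intros]:
  assumes "definable P" "definable Q"
  shows "definable (\<lambda>e. P e \<and> Q e)"
proof -
  have "enc ` {e. P e \<and> Q e} = enc ` {e. P e} \<inter> enc ` {e. Q e}" by auto
  then show ?thesis using assms inter_mem by (simp add: definable_def)
qed

lemma definable_not [definable_intros]:
  fixes P :: "'e::real_coded \<Rightarrow> bool"
  assumes "definable P"
  shows "definable (\<lambda>e. \<not> P e)"
proof -
  have "enc ` {e. \<not> P e} = {xs. length xs = edim TYPE('e)} - enc ` {e. P e}"
    using enc_Collect[of "\<lambda>xs. xs \<notin> enc ` {e. P e}", where 'a = 'e]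
    by (simp add: set_diff_eq)
  then show ?thesis using assms compl_mem by (simp add: definable_def)
qed

lemma definable_disj [definable_intros]:
  assumes "definable P" "definable Q"
  shows "definable (\<lambda>e. P e \<or> Q e)"
  using definable_not[OF definable_conj[OF assms[THEN definable_not]]] by simp

lemma definable_imp [definable_intros]:
  assumes "definable P" "definable Q"
  shows "definable (\<lambda>e. P e \<longrightarrow> Q e)"
  using definable_disj[OF definable_not[OF assms(1)] assms(2)] by simp

text \<open>Since \<open>enc\<close> lists the bound variable after the free ones, the quantifier is
  an iterated projection forgetting the last block.\<close>

lemma definable_ex [definable_intros]:
  fixes P :: "'e::real_coded \<Rightarrow> 'y::real_coded \<Rightarrow> bool"
  assumes "definable (\<lambda>z. P (fst z) (snd z))"
  shows "definable (\<lambda>e. \<exists>y. P e y)"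
proof -
  have "take (edim TYPE('e)) ` enc ` {z :: 'e \<times> 'y. P (fst z) (snd z)} \<in> S (edim TYPE('e))"
    using assms by (intro take_mem) (simp add: definable_def edim_prod_def)
  also have "take (edim TYPE('e)) ` enc ` {z :: 'e \<times> 'y. P (fst z) (snd z)} = enc ` {e. \<exists>y. P e y}"
  proof -
    have "fst ` {z :: 'e \<times> 'y. P (fst z) (snd z)} = {e. \<exists>y. P e y}"
      by (auto simp: image_iff)
    then show ?thesis unfolding image_image by (simp add: enc_prod_def flip: image_image)
  qed
  finally show ?thesis by (simp add: definable_def)
qed

lemma definable_all [definable_intros]:
  assumes "definable (\<lambda>z. P (fst z) (snd z))"
  shows "definable (\<lambda>e. \<forall>y. P e y)"
  using definable_not[OF definable_ex[OF definable_not[OF assms]]] by simp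

lemma definable_bex [definable_intros]:
  assumes "definable (\<lambda>z. snd z \<in> A (fst z))" "definable (\<lambda>z. P (fst z) (snd z))"
  shows "definable (\<lambda>e. \<exists>y\<in>A e. P e y)"
  unfolding Bex_def by (intro definable_intros assms)

lemma definable_ball [definable_intros]:
  assumes "definable (\<lambda>z. snd z \<in> A (fst z))" "definable (\<lambda>z. P (fst z) (snd z))"
  shows "definable (\<lambda>e. \<forall>y\<in>A e. P e y)"
  unfolding Ball_def by (intro definable_intros assms)

lemma definable_finite_all:
  assumes "finite I" "\<And>i. i \<in> I \<Longrightarrow> definable (P i)"
  shows "definable (\<lambda>e :: 'e::real_coded. \<forall>i\<in>I. P i e)"
proof -
  have *: "{xs. length xs = edim TYPE('e) \<and> xs \<in> enc ` {e :: 'e. Q e}} = enc ` {e. Q e}" for Q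
    by auto
  have "{xs. length xs = edim TYPE('e) \<and> (\<forall>i\<in>I. xs \<in> enc ` {e. P i e})} \<in> S (edim TYPE('e))"
    using assms(2) by (intro finite_inter_mem assms(1)) (simp add: definable_def *)
  also have "{xs. length xs = edim TYPE('e) \<and> (\<forall>i\<in>I. xs \<in> enc ` {e. P i e})} =
      enc ` {e. \<forall>i\<in>I. P i e}"
    by (simp add: enc_Collect)
  finally show ?thesis by (simp add: definable_def)
qed

text \<open>Maps that only select, repeat or permute coordinates. These are the substitutions
  covered by \<open>reindex_mem\<close>, and they bootstrap the substitution of arbitrary definable
  functions in \<open>definable_comp\<close>.\<close>

definition coordinate_map :: "('e::real_coded \<Rightarrow> 'a::real_coded) \<Rightarrow> bool" where
  "coordinate_map f \<longleftrightarrow>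
     (\<exists>\<sigma>. set \<sigma> \<subseteq> {..<edim TYPE('e)} \<and> (\<forall>e. enc (f e) = map ((!) (enc e)) \<sigma>))"

lemma coordinate_map_id: "coordinate_map (\<lambda>e. e)"
  unfolding coordinate_map_def
  by (rule exI[of _ "[0..<edim TYPE('a)]"]) (auto intro!: nth_equalityI)

lemma coordinate_map_fst:
  assumes "coordinate_map f"
  shows "coordinate_map (\<lambda>e. fst (f e :: 'a::real_coded \<times> 'b::real_coded))"
proof -
  obtain \<sigma> where \<sigma>: "set \<sigma> \<subseteq> {..<edim TYPE('c)}" "\<And>e. enc (f e) = map ((!) (enc e)) \<sigma>"
    using assms unfolding coordinate_map_def by blast
  have "enc (fst (f e)) = take (edim TYPE('a)) (enc (f e))" for e by (simp add: enc_prod_def)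
  then have "enc (fst (f e)) = map ((!) (enc e)) (take (edim TYPE('a)) \<sigma>)" for e
    by (simp add: \<sigma>(2) take_map)
  then show ?thesis
    unfolding coordinate_map_def using \<sigma>(1) set_take_subset by fast
qed

lemma coordinate_map_snd:
  assumes "coordinate_map f"
  shows "coordinate_map (\<lambda>e. snd (f e :: 'a::real_coded \<times> 'b::real_coded))"
proof -
  obtain \<sigma> where \<sigma>: "set \<sigma> \<subseteq> {..<edim TYPE('c)}" "\<And>e. enc (f e) = map ((!) (enc e)) \<sigma>"
    using assms unfolding coordinate_map_def by blast
  have "enc (snd (f e)) = drop (edim TYPE('a)) (enc (f e))" for e by (simp add: enc_prod_def)
  then have "enc (snd (f e)) = map ((!) (enc e)) (drop (edim TYPE('a)) \<sigma>)" for e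
    by (simp add: \<sigma>(2) drop_map)
  then show ?thesis
    unfolding coordinate_map_def using \<sigma>(1) set_drop_subset by fast
qed

lemma coordinate_map_Pair:
  assumes "coordinate_map f" "coordinate_map g"
  shows "coordinate_map (\<lambda>e. (f e, g e))"
proof -
  obtain \<sigma> where \<sigma>: "set \<sigma> \<subseteq> {..<edim TYPE('a)}" "\<And>e. enc (f e) = map ((!) (enc e)) \<sigma>"
    using assms unfolding coordinate_map_def by blast
  obtain \<tau> where \<tau>: "set \<tau> \<subseteq> {..<edim TYPE('a)}" "\<And>e. enc (g e) = map ((!) (enc e)) \<tau>"
    using assms unfolding coordinate_map_def by blast
  show ?thesis
    unfolding coordinate_map_def by (rule exI[of _ "\<sigma> @ \<tau>"]) (use \<sigma> \<tau> in \<open>auto simp: enc_prod_def\<close>)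
qed

lemma coordinate_map_nth: "coordinate_map (\<lambda>x :: real ^ 'n. x $ i)"
proof -
  obtain j where "j < CARD('n)" "index_list ! j = i"
    using index_list(2) by (metis UNIV_I in_set_conv_nth length_index_list)
  then show ?thesis
    unfolding coordinate_map_def
    by (intro exI[of _ "[j]"])
      (auto simp: enc_vec_def enc_real_def edim_vec_def to_real_real_def length_index_list)
qed

lemmas coordinate_map_intros =
  coordinate_map_id coordinate_map_fst coordinate_map_snd coordinate_map_Pair

lemma definable_reindex:
  fixes f :: "'e::real_coded \<Rightarrow> 'a::real_coded"
  assumes "definable P" "coordinate_map f"
  shows "definable (\<lambda>e. P (f e))"
proof -
  obtain \<sigma> where \<sigma>: "set \<sigma> \<subseteq> {..<edim TYPE('e)}" "\<And>e. enc (f e) = map ((!) (enc e)) \<sigma>"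
    using assms unfolding coordinate_map_def by blast
  have "length \<sigma> = edim TYPE('a)" by (metis \<sigma>(2) length_enc length_map)
  then have "{xs. length xs = edim TYPE('e) \<and> map ((!) xs) \<sigma> \<in> enc ` {e. P e}} \<in> S (edim TYPE('e))"
    using assms(1) \<sigma>(1) by (intro reindex_mem) (auto simp: definable_def)
  also have "{xs. length xs = edim TYPE('e) \<and> map ((!) xs) \<sigma> \<in> enc ` {e. P e}} = enc ` {e. P (f e)}"
    by (simp add: enc_Collect flip: \<sigma>(2))
  finally show ?thesis by (simp add: definable_def)
qed

lemma definable_diagonal: "definable (\<lambda>z :: 'a::real_coded \<times> 'a. fst z = snd z)"
proof -
  let ?d = "edim TYPE('a)"
  have "{xs. length xs = ?d + ?d \<and> (\<forall>i\<in>{..<?d}. xs ! i = xs ! (?d + i))} \<in> S (?d + ?d)"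
    by (intro finite_inter_mem eq_coord_mem) auto
  also have "{xs. length xs = ?d + ?d \<and> (\<forall>i\<in>{..<?d}. xs ! i = xs ! (?d + i))} =
      enc ` {z :: 'a \<times> 'a. fst z = snd z}"
  proof -
    have "(\<forall>i\<in>{..<?d}. enc z ! i = enc z ! (?d + i)) \<longleftrightarrow> enc (fst z) = enc (snd z)"
      for z :: "'a \<times> 'a"
      by (auto simp: enc_prod_def nth_append list_eq_iff_nth_eq)
    then show ?thesis
      using enc_Collect[of "\<lambda>xs. \<forall>i\<in>{..<?d}. xs ! i = xs ! (?d + i)", where 'a = "'a \<times> 'a"]
      by (simp add: edim_prod_def)
  qed
  finally show ?thesis by (simp add: definable_def edim_prod_def)
qed

lemma coordinate_map_definable_fun:
  fixes f :: "'e::real_coded \<Rightarrow> 'a::real_coded"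
  assumes "coordinate_map f"
  shows "definable_fun f"
proof -
  have "coordinate_map (\<lambda>z :: 'e \<times> 'a. f (fst z))"
  proof -
    obtain \<sigma> where \<sigma>: "set \<sigma> \<subseteq> {..<edim TYPE('e)}" "\<And>e. enc (f e) = map ((!) (enc e)) \<sigma>"
      using assms unfolding coordinate_map_def by blast
    have "enc (f (fst z)) = map ((!) (enc z)) \<sigma>" for z :: "'e \<times> 'a"
      using \<sigma> by (auto simp: enc_prod_def nth_append)
    then show ?thesis
      unfolding coordinate_map_def using \<sigma>(1) by (intro exI[of _ \<sigma>]) (auto simp: edim_prod_def)
  qed
  then show ?thesis
    using definable_reindex[OF definable_diagonal
        coordinate_map_Pair[OF coordinate_map_snd[OF coordinate_map_id]]]
    by (simp add: definable_fun_def)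
qed

text \<open>The value of \<open>f\<close> becomes a bound variable: \<open>P (f e)\<close> is
  \<open>\<exists>y. y = f e \<and> P y\<close>. Only coordinate maps then have to be substituted
  directly.\<close>

lemma definable_comp:
  assumes "definable P" "definable_fun f"
  shows "definable (\<lambda>e. P (f e))"
proof -
  have "definable (\<lambda>e. \<exists>y. y = f e \<and> P y)"
    using assms(2) definable_reindex[OF assms(1), of snd]
    by (intro definable_ex definable_conj) (auto simp: definable_fun_def coordinate_map_intros)
  then show ?thesis by simp
qed

lemma definable_fun_comp:
  assumes "definable_fun g" "definable_fun f"
  shows "definable_fun (\<lambda>e. g (f e))"
proof -
  have "definable (\<lambda>z. \<exists>w. w = f (fst z) \<and> snd z = g w)"
    using definable_reindex[OF assms(1)[unfolded definable_fun_def], of "\<lambda>u. (snd u, snd (fst u))"]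
      definable_reindex[OF assms(2)[unfolded definable_fun_def], of "\<lambda>u. (fst (fst u), snd u)"]
    by (intro definable_ex definable_conj) (auto simp: coordinate_map_intros)
  then show ?thesis by (simp add: definable_fun_def)
qed

lemma definable_fun_id [definable_intros]: "definable_fun (\<lambda>e. e)"
  by (intro coordinate_map_definable_fun coordinate_map_intros)

lemma definable_fun_fst [definable_intros]: "definable_fun f \<Longrightarrow> definable_fun (\<lambda>e. fst (f e))"
  by (rule definable_fun_comp[of fst]) (intro coordinate_map_definable_fun coordinate_map_intros)

lemma definable_fun_snd [definable_intros]: "definable_fun f \<Longrightarrow> definable_fun (\<lambda>e. snd (f e))"
  by (rule definable_fun_comp[of snd]) (intro coordinate_map_definable_fun coordinate_map_intros)

lemma definable_fun_nth [definable_intros]: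
  "definable_fun f \<Longrightarrow> definable_fun (\<lambda>e. (f e :: real ^ 'n) $ i)"
  by (rule definable_fun_comp[of "\<lambda>x. x $ i"])
    (intro coordinate_map_definable_fun coordinate_map_nth)

lemma definable_fun_Pair [definable_intros]:
  assumes "definable_fun f" "definable_fun g"
  shows "definable_fun (\<lambda>e. (f e, g e))"
proof -
  have "definable (\<lambda>z. fst (snd z) = f (fst z) \<and> snd (snd z) = g (fst z))"
    using definable_reindex[OF assms(1)[unfolded definable_fun_def], of "\<lambda>u. (fst u, fst (snd u))"]
      definable_reindex[OF assms(2)[unfolded definable_fun_def], of "\<lambda>u. (fst u, snd (snd u))"]
    by (intro definable_conj) (auto simp: coordinate_map_intros)
  moreover have "(\<lambda>z. fst (snd z) = f (fst z) \<and> snd (snd z) = g (fst z)) =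
      (\<lambda>z. snd z = (f (fst z), g (fst z)))"
    by (auto simp: prod_eq_iff)
  ultimately show ?thesis by (simp add: definable_fun_def)
qed

lemma definable_eq [definable_intros]:
  assumes "definable_fun f" "definable_fun g"
  shows "definable (\<lambda>e. f e = g e)"
  using definable_comp[OF definable_diagonal definable_fun_Pair[OF assms]] by simp

lemma definable_comp2:
  assumes "definable (\<lambda>z. P (fst z) (snd z))" "definable_fun f" "definable_fun g"
  shows "definable (\<lambda>e. P (f e) (g e))"
  using definable_comp[OF assms(1) definable_fun_Pair[OF assms(2,3)]] by simp

text \<open>For functions given implicitly, such as differences, quotients, roots and extrema: any
  definable characterisation of the value describes the graph.\<close>

lemma definable_funI:
  assumes "\<And>e y. y = f e \<longleftrightarrow> P (e, y)" "definable P"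
  shows "definable_fun f"
proof -
  have "P = (\<lambda>z. snd z = f (fst z))" by (rule ext) (use assms(1) in auto)
  then show ?thesis using assms(2) by (simp add: definable_fun_def)
qed

lemma definable_fun_vec:
  assumes "\<And>i. definable_fun (\<lambda>e. f e $ i)"
  shows "definable_fun (f :: 'e::real_coded \<Rightarrow> real ^ 'n)"
proof (rule definable_funI)
  show "definable (\<lambda>z. \<forall>i\<in>UNIV. snd z $ i = f (fst z) $ i)"
    by (intro definable_finite_all definable_eq definable_intros
        definable_fun_comp[OF assms]) auto
qed (auto simp: vec_eq_iff)


lemma singleton_list_mem: "{xs} \<in> S (length xs)"
proof -
  have "{ys. length ys = length xs \<and> (\<forall>i\<in>{..<length xs}. ys ! i = xs ! i)} \<in> S (length xs)"
  proof (intro finite_inter_mem)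
    fix i assume "i \<in> {..<length xs}"
    then have "{ys. length ys = length xs \<and> map ((!) ys) [i] \<in> {[xs ! i]}} \<in> S (length xs)"
      using singleton_mem by (intro reindex_mem[where k = 1]) auto
    then show "{ys. length ys = length xs \<and> ys ! i = xs ! i} \<in> S (length xs)" by simp
  qed auto
  also have "{ys. length ys = length xs \<and> (\<forall>i\<in>{..<length xs}. ys ! i = xs ! i)} = {xs}"
    by (auto intro: nth_equalityI)
  finally show ?thesis .
qed

lemma definable_fun_const [definable_intros]: "definable_fun (\<lambda>e. c)"
proof -
  have "definable (\<lambda>r. r = c)"
    using singleton_list_mem[of "enc c"] by (simp add: definable_def)
  then show ?thesis
    unfolding definable_fun_def by (rule definable_reindex) (intro coordinate_map_intros)
qed

end

lemma bdd_above_infdist: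
  assumes "bounded A" "B \<noteq> {}"
  shows "bdd_above ((\<lambda>x. infdist x B) ` A)"
proof -
  obtain d where d: "d \<in> B" using assms(2) by blast
  obtain M where M: "dist d x \<le> M" if "x \<in> A" for x
    using assms(1) unfolding bounded_any_center[of _ d] by auto
  have "infdist x B \<le> M" if "x \<in> A" for x
    using infdist_le[OF d, of x] M[OF that] by (simp add: dist_commute)
  then show ?thesis by (rule bdd_aboveI2)
qed

section \<open>Arithmetic, order, extrema and distances\<close>

context o_minimal_structure
begin

lemma definable_fun_lift: "definable_fun f \<Longrightarrow> definable_fun (\<lambda>z. f (fst z))"
  by (erule definable_fun_comp) (intro definable_intros)

lemma definable_fun_binop:
  assumes h: "{[x, y, h x y] | x y. True} \<in> S 3"
    and fg: "definable_fun f" "definable_fun g"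
  shows "definable_fun (\<lambda>e. h (f e) (g e))"
proof -
  have "enc ` {z :: (real \<times> real) \<times> real. snd z = h (fst (fst z)) (snd (fst z))} =
      {[x, y, h x y] | x y. True}" (is "?L = ?R")
  proof (intro equalityI subsetI)
    fix xs assume "xs \<in> ?R"
    then obtain x y where "xs = [x, y, h x y]" by blast
    then have "xs = enc ((x, y), h x y)" by (simp add: enc_prod_def enc_real_def)
    then show "xs \<in> ?L" by (rule image_eqI) simp
  qed (auto simp: enc_prod_def enc_real_def)
  then have "definable (\<lambda>z :: (real \<times> real) \<times> real. snd z = h (fst (fst z)) (snd (fst z)))"
    using h by (simp add: definable_def edim_prod_def edim_real_def numeral_3_eq_3)
  then have "definable_fun (\<lambda>z :: real \<times> real. h (fst z) (snd z))"
    by (simp add: definable_fun_def)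
  from definable_fun_comp[OF this definable_fun_Pair[OF fg]] show ?thesis by simp
qed

lemmas definable_fun_add [definable_intros] = definable_fun_binop[OF add_mem]
lemmas definable_fun_mult [definable_intros] = definable_fun_binop[OF mult_mem]

text \<open>The order is recovered from the field: a real is non-negative exactly if it is a
  square.\<close>

lemma definable_le [definable_intros]:
  fixes f g :: "'e::real_coded \<Rightarrow> real"
  assumes "definable_fun f" "definable_fun g"
  shows "definable (\<lambda>e. f e \<le> g e)"
proof -
  have "definable (\<lambda>e. \<exists>z :: real. g e = f e + z * z)"
    by (intro definable_intros assms[THEN definable_fun_lift])
  moreover have "(\<exists>z. g e = f e + z * z) \<longleftrightarrow> f e \<le> g e" for e
  proof
    assume "f e \<le> g e"
    then have "g e = f e + sqrt (g e - f e) * sqrt (g e - f e)" by simp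
    then show "\<exists>z. g e = f e + z * z" by blast
  qed auto
  ultimately show ?thesis by simp
qed

lemma definable_less [definable_intros]:
  fixes f g :: "'e::real_coded \<Rightarrow> real"
  assumes "definable_fun f" "definable_fun g"
  shows "definable (\<lambda>e. f e < g e)"
  using definable_not[OF definable_le[OF assms(2,1)]] by (simp add: not_le)

lemma definable_fun_diff [definable_intros]:
  fixes f g :: "'e::real_coded \<Rightarrow> real"
  assumes "definable_fun f" "definable_fun g"
  shows "definable_fun (\<lambda>e. f e - g e)"
proof (rule definable_funI)
  show "definable (\<lambda>z. snd z + g (fst z) = f (fst z))"
    by (intro definable_intros assms[THEN definable_fun_lift])
qed auto

lemma definable_fun_uminus [definable_intros]:
  fixes f :: "'e::real_coded \<Rightarrow> real"
  assumes "definable_fun f"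
  shows "definable_fun (\<lambda>e. - f e)"
  using definable_fun_diff[OF definable_fun_const assms, of 0] by simp

lemma definable_fun_divide [definable_intros]:
  fixes f g :: "'e::real_coded \<Rightarrow> real"
  assumes "definable_fun f" "definable_fun g"
  shows "definable_fun (\<lambda>e. f e / g e)"
proof (rule definable_funI)
  \<comment> \<open>The first disjunct encodes the convention that division by \<open>0\<close>
    gives \<open>0\<close>.\<close>
  show "definable (\<lambda>z. g (fst z) = 0 \<and> snd z = 0 \<or>
      \<not> g (fst z) = 0 \<and> snd z * g (fst z) = f (fst z))"
    by (intro definable_intros assms[THEN definable_fun_lift])
qed (auto simp: field_simps split: if_splits)

lemma definable_fun_if [definable_intros]:
  assumes "definable P" "definable_fun f" "definable_fun g"
  shows "definable_fun (\<lambda>e. if P e then f e else g e)"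
proof (rule definable_funI)
  show "definable (\<lambda>z. P (fst z) \<and> snd z = f (fst z) \<or> \<not> P (fst z) \<and> snd z = g (fst z))"
    by (intro definable_intros assms(2,3)[THEN definable_fun_lift] definable_comp[OF assms(1)])
qed auto

lemma definable_fun_max [definable_intros]:
  fixes f g :: "'e::real_coded \<Rightarrow> real"
  assumes "definable_fun f" "definable_fun g"
  shows "definable_fun (\<lambda>e. max (f e) (g e))"
  unfolding max_def by (intro definable_intros assms)

lemma definable_fun_power [definable_intros]:
  fixes f :: "'e::real_coded \<Rightarrow> real"
  assumes "definable_fun f"
  shows "definable_fun (\<lambda>e. f e ^ n)"
  by (induction n) (auto intro!: definable_intros assms)

lemma definable_fun_abs [definable_intros]:
  fixes f :: "'e::real_coded \<Rightarrow> real"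
  assumes "definable_fun f"
  shows "definable_fun (\<lambda>e. \<bar>f e\<bar>)"
  unfolding abs_if by (intro definable_intros assms)

lemma definable_fun_sqrt [definable_intros]:
  fixes f :: "'e::real_coded \<Rightarrow> real"
  assumes "definable_fun f"
  shows "definable_fun (\<lambda>e. sqrt (f e))"
proof (rule definable_funI)
  \<comment> \<open>The library's square root is odd, so this describes it at negative arguments too.\<close>
  show "definable (\<lambda>z. snd z * \<bar>snd z\<bar> = f (fst z))"
    by (intro definable_intros assms[THEN definable_fun_lift])
  have *: "sqrt (y * \<bar>y\<bar>) = y" for y
    by (cases "y \<ge> 0") (auto simp: real_sqrt_minus)
  show "y = sqrt (f e) \<longleftrightarrow> snd (e, y) * \<bar>snd (e, y)\<bar> = f (fst (e, y))" for e y
    using *[of y] by (cases "f e \<ge> 0") (auto simp flip: real_sqrt_minus)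
qed

lemma definable_fun_sum [definable_intros]:
  fixes f :: "'i \<Rightarrow> 'e::real_coded \<Rightarrow> real"
  assumes "\<And>i. definable_fun (f i)"
  shows "definable_fun (\<lambda>e. \<Sum>i\<in>I. f i e)"
proof (induction I rule: infinite_finite_induct)
  case (insert i I)
  then show ?case using definable_fun_add[OF assms insert.IH] by simp
qed (auto intro: definable_intros)

lemma definable_fun_dist_vec [definable_intros]:
  fixes f g :: "'e::real_coded \<Rightarrow> real ^ 'n"
  assumes "definable_fun f" "definable_fun g"
  shows "definable_fun (\<lambda>e. dist (f e) (g e))"
  unfolding dist_vec_def L2_set_def dist_real_def by (intro definable_intros assms)

lemma definable_fun_dist_vec_real [definable_intros]:
  fixes f g :: "'e::real_coded \<Rightarrow> (real ^ 'n) \<times> real"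
  assumes "definable_fun f" "definable_fun g"
  shows "definable_fun (\<lambda>e. dist (f e) (g e))"
  unfolding dist_prod_def dist_real_def by (intro definable_intros assms)

text \<open>Being the greatest lower bound is a first-order condition, and \<open>Inf\<close> has
  this meaning for non-empty sets that are bounded below.\<close>

lemma definable_fun_Inf:
  fixes A :: "'e::real_coded \<Rightarrow> real set"
  assumes "definable (\<lambda>z. snd z \<in> A (fst z))" "\<And>e. A e \<noteq> {}" "\<And>e. bdd_below (A e)"
  shows "definable_fun (\<lambda>e. Inf (A e))"
proof (rule definable_funI)
  show "definable (\<lambda>z. (\<forall>s\<in>A (fst z). snd z \<le> s) \<and>
      (\<forall>t :: real. (\<forall>s\<in>A (fst z). t \<le> s) \<longrightarrow> t \<le> snd z))"
    by (intro definable_intros definable_comp2[OF assms(1)])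
  show "y = Inf (A e) \<longleftrightarrow> (\<forall>s\<in>A (fst (e, y)). snd (e, y) \<le> s) \<and>
      (\<forall>t. (\<forall>s\<in>A (fst (e, y)). t \<le> s) \<longrightarrow> t \<le> snd (e, y))" for e y
    using assms(2)[of e] assms(3)[of e]
    by (auto intro: cInf_lower cInf_greatest order.antisym)
qed

lemma definable_fun_Sup:
  fixes A :: "'e::real_coded \<Rightarrow> real set"
  assumes "definable (\<lambda>z. snd z \<in> A (fst z))" "\<And>e. A e \<noteq> {}" "\<And>e. bdd_above (A e)"
  shows "definable_fun (\<lambda>e. Sup (A e))"
proof (rule definable_funI)
  show "definable (\<lambda>z. (\<forall>s\<in>A (fst z). s \<le> snd z) \<and>
      (\<forall>t :: real. (\<forall>s\<in>A (fst z). s \<le> t) \<longrightarrow> snd z \<le> t))"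
    by (intro definable_intros definable_comp2[OF assms(1)])
  show "y = Sup (A e) \<longleftrightarrow> (\<forall>s\<in>A (fst (e, y)). s \<le> snd (e, y)) \<and>
      (\<forall>t. (\<forall>s\<in>A (fst (e, y)). s \<le> t) \<longrightarrow> snd (e, y) \<le> t)" for e y
    using assms(2)[of e] assms(3)[of e]
    by (auto intro: cSup_upper cSup_least order.antisym)
qed

text \<open>Definability of the metric is a hypothesis so that one proof serves both
  \<open>real ^ 'n\<close> and the ambient space \<open>(real ^ 'n) \<times> real\<close> of the
  sphere.\<close>

lemma definable_fun_infdist:
  fixes f :: "'e::real_coded \<Rightarrow> 'a::{real_coded, metric_space}"
  assumes dist: "definable_fun (\<lambda>z :: 'a \<times> 'a. dist (fst z) (snd z))"
    and f: "definable_fun f"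
    and A: "definable (\<lambda>z. snd z \<in> A (fst z))" "\<And>e. A e \<noteq> {}"
  shows "definable_fun (\<lambda>e. infdist (f e) (A e))"
proof -
  have "definable_fun (\<lambda>e. dist (g e) (h e :: 'a))"
    if "definable_fun g" "definable_fun h" for g h :: "'c::real_coded \<Rightarrow> 'a"
    using definable_fun_comp[OF dist definable_fun_Pair[OF that]] by simp
  note dist' = this
  have "definable_fun (\<lambda>e. Inf ((\<lambda>a. dist (f e) a) ` A e))"
  proof (rule definable_fun_Inf)
    have "definable (\<lambda>z. \<exists>a\<in>A (fst z). snd z = dist (f (fst z)) a)"
      by (intro definable_intros dist' definable_fun_comp[OF f] definable_comp2[OF A(1)])
    then show "definable (\<lambda>z. snd z \<in> (\<lambda>a. dist (f (fst z)) a) ` A (fst z))"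
      by (simp add: image_iff)
  qed (use A(2) in \<open>auto intro!: bdd_belowI[of _ 0]\<close>)
  then show ?thesis by (simp add: infdist_notempty A(2))
qed

lemma definable_fun_dist_H:
  fixes A B :: "'e::real_coded \<Rightarrow> 'a::{real_coded, metric_space} set"
  assumes dist: "definable_fun (\<lambda>z :: 'a \<times> 'a. dist (fst z) (snd z))"
    and A: "definable (\<lambda>z. snd z \<in> A (fst z))" "\<And>e. A e \<noteq> {}" "\<And>e. bounded (A e)"
    and B: "definable (\<lambda>z. snd z \<in> B (fst z))" "\<And>e. B e \<noteq> {}" "\<And>e. bounded (B e)"
  shows "definable_fun (\<lambda>e. dist_H (A e) (B e))"
proof -
  have "definable_fun (\<lambda>e. SUP x\<in>C e. infdist x (D e))"
    if C: "definable (\<lambda>z. snd z \<in> C (fst z))" "\<And>e. C e \<noteq> {}" "\<And>e. bounded (C e)"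
      and D: "definable (\<lambda>z. snd z \<in> D (fst z))" "\<And>e. D e \<noteq> {}"
    for C D :: "'e \<Rightarrow> 'a set"
  proof (rule definable_fun_Sup)
    have "definable (\<lambda>z. \<exists>x\<in>C (fst z). snd z = infdist x (D (fst z)))"
      using D(2)
      by (intro definable_intros definable_comp2[OF C(1)] definable_comp2[OF D(1)]
          definable_fun_infdist[OF dist])
    then show "definable (\<lambda>z. snd z \<in> (\<lambda>x. infdist x (D (fst z))) ` C (fst z))"
      by (simp add: image_iff)
    show "bdd_above ((\<lambda>x. infdist x (D e)) ` C e)" for e
      by (rule bdd_above_infdist[OF C(3) D(2)])
  qed (use C(2) in auto)
  from definable_fun_max[OF this[OF A B(1,2)] this[OF B A(1,2)]] show ?thesis
    by (simp add: dist_H_def)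
qed

end

section \<open>Definable functions of one variable\<close>

text \<open>If \<open>I\<close> has points arbitrarily close to \<open>c\<close> on the right,
  convexity fills in everything between them and one fixed point of \<open>I\<close> beyond
  \<open>c\<close>.\<close>

lemma is_interval_eventually_at_right:
  fixes I :: "real set"
  assumes "is_interval I"
  shows "(\<forall>\<^sub>F t in at_right c. t \<in> I) \<or> (\<forall>\<^sub>F t in at_right c. t \<notin> I)"
proof (rule disjCI)
  assume "\<not> (\<forall>\<^sub>F t in at_right c. t \<notin> I)"
  then have near: "\<exists>t>c. t < b \<and> t \<in> I" if "b > c" for b
    using that unfolding eventually_at_right_field by blast
  obtain b where b: "b > c" "b \<in> I" using near[of "c + 1"] by auto
  have "t \<in> I" if "c < t" "t < b" for t
  proof -
    obtain s where "c < s" "s < t" "s \<in> I" using near \<open>c < t\<close> by blast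
    then show ?thesis
      using assms b that unfolding is_interval_1 by (meson less_imp_le)
  qed
  then show "\<forall>\<^sub>F t in at_right c. t \<in> I"
    unfolding eventually_at_right_field using b by blast
qed

text \<open>The last point \<open>u\<close> of \<open>{s..t}\<close> with
  \<open>f s \<le> f u\<close> exists by compactness; if it were not \<open>t\<close>, the local
  condition would provide a later one. This stands in for the mean value theorem when only
  right-hand information is available.\<close>

lemma increasing_of_locally_increasing_right:
  fixes f :: "real \<Rightarrow> real"
  assumes "s \<le> t" "continuous_on {s..t} f"
    and right: "\<And>u. s \<le> u \<Longrightarrow> u < t \<Longrightarrow> \<forall>\<^sub>F v in at_right u. f u \<le> f v"
  shows "f s \<le> f t"
proof -
  let ?A = "{u \<in> {s..t}. f s \<le> f u}"
  have "closed ?A"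
    by (intro continuous_on_closed_Collect_le assms continuous_on_const) auto
  moreover have "?A = {s..t} \<inter> ?A" by auto
  ultimately have "compact ?A" using compact_Int_closed[of "{s..t}" ?A] by simp
  moreover have "?A \<noteq> {}" using assms(1) by auto
  ultimately obtain u where u: "u \<in> ?A" "\<And>v. v \<in> ?A \<Longrightarrow> v \<le> u"
    using compact_attains_sup[of ?A] by blast
  have "u = t"
  proof (rule ccontr)
    assume "u \<noteq> t"
    then have "u < t" using u by auto
    then obtain b where b: "b > u" "\<And>v. v > u \<Longrightarrow> v < b \<Longrightarrow> f u \<le> f v"
      using right[of u] u(1) unfolding eventually_at_right_field by auto
    obtain v where "u < v" "v < min b t" using \<open>u < t\<close> b dense[of u "min b t"] by auto
    then have "v \<in> ?A" using b(2)[of v] u(1) by auto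
    then show False using u(2) \<open>u < v\<close> by fastforce
  qed
  then show ?thesis using u by simp
qed

context o_minimal_structure
begin

lemma definable_real_intervals:
  assumes "definable (P :: real \<Rightarrow> bool)"
  obtains \<I> where "finite \<I>" "\<And>I. I \<in> \<I> \<Longrightarrow> is_interval I" "{t. P t} = \<Union>\<I>"
proof -
  have "enc ` {t. P t} \<in> S 1" using assms by (simp add: definable_def edim_real_def)
  moreover have "{x. [x] \<in> enc ` {t. P t}} = {t. P t}" by (auto simp: enc_real_def)
  ultimately show thesis using o_minimal that by metis
qed

text \<open>Each of finitely many intervals decides membership near \<open>c\<close> on the right,
  hence so does their union.\<close>

lemma definable_eventually_at_right:
  assumes "definable (P :: real \<Rightarrow> bool)"
  shows "(\<forall>\<^sub>F t in at_right c. P t) \<or> (\<forall>\<^sub>F t in at_right c. \<not> P t)"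
proof -
  obtain \<I> where \<I>: "finite \<I>" "\<And>I. I \<in> \<I> \<Longrightarrow> is_interval I" "{t. P t} = \<Union>\<I>"
    using definable_real_intervals[OF assms] by blast
  have "(\<forall>\<^sub>F t in at_right c. t \<in> \<Union>\<I>) \<or> (\<forall>\<^sub>F t in at_right c. t \<notin> \<Union>\<I>)"
    using \<I>(1,2)
  proof (induction \<I> rule: finite_induct)
    case (insert I \<I>)
    have "(\<forall>\<^sub>F t in at_right c. t \<in> I) \<or> (\<forall>\<^sub>F t in at_right c. t \<notin> I)"
      using insert.prems by (intro is_interval_eventually_at_right) simp
    moreover have "(\<forall>\<^sub>F t in at_right c. t \<in> \<Union>\<I>) \<or> (\<forall>\<^sub>F t in at_right c. t \<notin> \<Union>\<I>)"
      using insert by simp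
    ultimately consider "\<forall>\<^sub>F t in at_right c. t \<in> I" | "\<forall>\<^sub>F t in at_right c. t \<in> \<Union>\<I>"
      | "\<forall>\<^sub>F t in at_right c. t \<notin> I \<and> t \<notin> \<Union>\<I>"
      unfolding eventually_conj_iff by blast
    then show ?case
      by cases (auto elim: eventually_mono)
  qed auto
  then show ?thesis unfolding \<I>(3)[symmetric] by simp
qed

section \<open>Continuity points of definable functions\<close>

lemma definable_infinite_interval:
  assumes "definable P" "infinite {t :: real. P t}"
  obtains a b where "a < b" "\<And>t. a \<le> t \<Longrightarrow> t \<le> b \<Longrightarrow> P t"
proof -
  obtain \<I> where \<I>: "finite \<I>" "\<And>I. I \<in> \<I> \<Longrightarrow> is_interval I" "{t. P t} = \<Union>\<I>"
    using definable_real_intervals[OF assms(1)] by blast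
  then obtain I where I: "I \<in> \<I>" "infinite I" using assms(2) finite_Union by metis
  obtain a where a: "a \<in> I" using I(2) by fastforce
  obtain b where b: "b \<in> I" "b \<noteq> a"
    using I(2) by (metis finite.emptyI finite_insert finite_subset insertI1 subsetI)
  have *: "P t" if "min a b \<le> t" "t \<le> max a b" for t
  proof -
    have "t \<in> I" using \<I>(2)[OF I(1)] a b that unfolding is_interval_1
      by (metis max_def min_def)
    then show ?thesis using I(1) \<I>(3) by blast
  qed
  show thesis by (rule that[of "min a b" "max a b"]) (use b * in auto)
qed

text \<open>
  The sets on which \<open>g\<close> lies between consecutive multiples of \<open>r\<close> are countably many and cover an
  uncountable interval, so one of them is infinite and therefore contains an interval.
\<close>

lemma definable_small_oscillation:
  fixes g :: "real \<Rightarrow> real"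
  assumes g: "definable_fun g" and "a < b" "r > 0"
  obtains a' b' where "a < a'" "a' < b'" "b' < b"
    "\<And>x y. x \<in> {a'..b'} \<Longrightarrow> y \<in> {a'..b'} \<Longrightarrow> \<bar>g x - g y\<bar> < r"
proof -
  define P where "P j t \<longleftrightarrow> a < t \<and> t < b \<and> of_int j * r \<le> g t \<and> g t < (of_int j + 1) * r" for j t
  have "{a<..<b} \<subseteq> (\<Union>j. {t. P j t})"
  proof
    fix t assume "t \<in> {a<..<b}"
    moreover have "of_int \<lfloor>g t / r\<rfloor> * r \<le> g t \<and> g t < (of_int \<lfloor>g t / r\<rfloor> + 1) * r"
      using \<open>r > 0\<close> by (metis floor_divide_lower floor_divide_upper)
    ultimately have "P \<lfloor>g t / r\<rfloor> t" by (simp add: P_def)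
    then show "t \<in> (\<Union>j. {t. P j t})" by blast
  qed
  moreover have "uncountable {a<..<b}" using \<open>a < b\<close> uncountable_open_interval by blast
  ultimately have "uncountable (\<Union>j. {t. P j t})" using countable_subset by blast
  then obtain j where "infinite {t. P j t}"
    by (metis countable_UN countableI_type countable_finite)
  moreover have "definable (P j)"
    unfolding P_def by (intro definable_intros g)
  ultimately obtain a' b' where *: "a' < b'" "\<And>t. a' \<le> t \<Longrightarrow> t \<le> b' \<Longrightarrow> P j t"
    using definable_infinite_interval by metis
  show thesis
  proof (rule that)
    show "a < a'" "b' < b" using *(1) *(2)[of a'] *(2)[of b'] by (auto simp: P_def)
    fix x y assume "x \<in> {a'..b'}" "y \<in> {a'..b'}"
    then have "P j x" "P j y" using *(2) by auto
    then show "\<bar>g x - g y\<bar> < r" by (auto simp: P_def algebra_simps)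
  qed fact
qed

text \<open>Nested intervals with oscillation below \<open>1 / Suc k\<close>. Both ends move
  strictly inwards at each stage, so the common point is interior to all the intervals and each
  oscillation bound holds on a neighbourhood of it.\<close>

lemma definable_continuity_point:
  fixes g :: "real \<Rightarrow> real"
  assumes g: "definable_fun g" and ab: "a < b"
  obtains t where "a < t" "t < b" "isCont g t"
proof -
  define small where "small k I \<longleftrightarrow> (\<forall>x\<in>{fst I..snd I}. \<forall>y\<in>{fst I..snd I}. \<bar>g x - g y\<bar> < 1 / Suc k)"
    for k :: nat and I :: "real \<times> real"
  have "\<exists>I. \<forall>k. (a < fst (I k) \<and> fst (I k) < snd (I k) \<and> snd (I k) < b \<and> small k (I k)) \<and>
      (fst (I k) < fst (I (Suc k)) \<and> snd (I (Suc k)) < snd (I k))"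
  proof (rule dependent_nat_choice)
    obtain a' b' where "a < a'" "a' < b'" "b' < b"
      "\<And>x y. x \<in> {a'..b'} \<Longrightarrow> y \<in> {a'..b'} \<Longrightarrow> \<bar>g x - g y\<bar> < 1"
      using definable_small_oscillation[OF g ab, of 1] by (metis zero_less_one)
    then show "\<exists>I. a < fst I \<and> fst I < snd I \<and> snd I < b \<and> small 0 I"
      by (intro exI[of _ "(a', b')"]) (auto simp: small_def)
  next
    fix I :: "real \<times> real" and k
    assume I: "a < fst I \<and> fst I < snd I \<and> snd I < b \<and> small k I"
    obtain a' b' where "fst I < a'" "a' < b'" "b' < snd I"
      "\<And>x y. x \<in> {a'..b'} \<Longrightarrow> y \<in> {a'..b'} \<Longrightarrow> \<bar>g x - g y\<bar> < 1 / Suc (Suc k)"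
      using definable_small_oscillation[OF g, of "fst I" "snd I" "1 / Suc (Suc k)"] I
      by (metis of_nat_0_less_iff zero_less_Suc zero_less_divide_1_iff)
    then show "\<exists>J. (a < fst J \<and> fst J < snd J \<and> snd J < b \<and> small (Suc k) J) \<and>
        (fst I < fst J \<and> snd J < snd I)"
      using I by (intro exI[of _ "(a', b')"]) (auto simp: small_def)
  qed
  then obtain I where I: "\<And>k. a < fst (I k)" "\<And>k. fst (I k) < snd (I k)" "\<And>k. snd (I k) < b"
    "\<And>k. small k (I k)" "\<And>k. fst (I k) < fst (I (Suc k))" "\<And>k. snd (I (Suc k)) < snd (I k)"
    by blast
  have mono: "fst (I j) \<le> fst (I k)" "snd (I k) \<le> snd (I j)" if "j \<le> k" for j k
    using lift_Suc_mono_le[of "\<lambda>k. fst (I k)"] lift_Suc_antimono_le[of "\<lambda>k. snd (I k)"]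
      I(5,6) that
    by (meson less_imp_le)+
  have le: "fst (I j) \<le> snd (I k)" for j k
    using mono(1)[of j "max j k"] mono(2)[of k "max j k"] I(2)[of "max j k"] by simp
  define t where "t = (SUP k. fst (I k))"
  have bdd: "bdd_above (range (\<lambda>k. fst (I k)))"
    using le[of _ 0] by (intro bdd_aboveI2)
  have ge: "fst (I k) \<le> t" for k
    unfolding t_def by (rule cSUP_upper[OF _ bdd]) simp
  have le': "t \<le> snd (I k)" for k
    unfolding t_def by (rule cSUP_least) (auto intro: le)
  have mem: "fst (I k) < t" "t < snd (I k)" for k
    using ge[of "Suc k"] le'[of "Suc k"] I(5,6)[of k] by auto
  have "isCont g t"
    unfolding continuous_at_eps_delta
  proof (intro allI impI)
    fix e :: real assume "e > 0"
    then obtain k where k: "1 / Suc k < e" using nat_approx_posE by metis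
    define d where "d = min (t - fst (I k)) (snd (I k) - t)"
    have "dist (g x) (g t) < e" if "dist x t < d" for x
    proof -
      have "x \<in> {fst (I k)..snd (I k)}" "t \<in> {fst (I k)..snd (I k)}"
        using that mem[of k] by (auto simp: d_def dist_real_def)
      then have "\<bar>g x - g t\<bar> < 1 / Suc k" using I(4)[of k] unfolding small_def by blast
      then show ?thesis using k by (simp add: dist_real_def)
    qed
    then show "\<exists>d>0. \<forall>x. dist x t < d \<longrightarrow> dist (g x) (g t) < e"
      using mem[of k] by (intro exI[of _ d]) (auto simp: d_def)
  qed
  moreover have "a < t" "t < b" using mem[of 0] I(1,3)[of 0] by auto
  ultimately show thesis using that by blast
qed

text \<open>Continuity at \<open>t\<close> is a first-order condition, so near \<open>c\<close> on
  the right it holds throughout or fails throughout; \<open>definable_continuity_point\<close>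
  excludes the latter.\<close>

lemma definable_eventually_isCont:
  fixes g :: "real \<Rightarrow> real"
  assumes g: "definable_fun g"
  shows "\<forall>\<^sub>F t in at_right c. isCont g t"
proof -
  have "definable (\<lambda>t. \<forall>e. e > 0 \<longrightarrow> (\<exists>d. d > 0 \<and> (\<forall>x. \<bar>x - t\<bar> < d \<longrightarrow> \<bar>g x - g t\<bar> < e)))"
    by (intro definable_intros definable_fun_comp[OF g])
  then have "definable (\<lambda>t. isCont g t)"
    by (simp add: continuous_at_eps_delta dist_real_def)
  moreover have "\<not> (\<forall>\<^sub>F t in at_right c. \<not> isCont g t)"
  proof
    assume "\<forall>\<^sub>F t in at_right c. \<not> isCont g t"
    then obtain b where b: "b > c" "\<And>t. t > c \<Longrightarrow> t < b \<Longrightarrow> \<not> isCont g t"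
      unfolding eventually_at_right_field by blast
    then show False using definable_continuity_point[OF g b(1)] by blast
  qed
  ultimately show ?thesis using definable_eventually_at_right by blast
qed

text \<open>A comparison with the lower right Dini derivative, which is the supremum of all such
  \<open>c\<close>. Working with the predicate avoids infinite values.\<close>

definition slope_ge :: "(real \<Rightarrow> real) \<Rightarrow> real \<Rightarrow> real \<Rightarrow> bool" where
  "slope_ge g t c \<longleftrightarrow> (\<forall>\<^sub>F v in at_right t. c * (v - t) \<le> g v - g t)"

lemma slope_ge_mono:
  assumes "slope_ge g t c" "c' \<le> c"
  shows "slope_ge g t c'"
proof -
  have "\<forall>\<^sub>F v in at_right t. t < v" by (simp add: eventually_at_right_less)
  with assms(1) show ?thesis
    unfolding slope_ge_def
  proof eventually_elim
    case (elim v)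
    have "c' * (v - t) \<le> c * (v - t)" using elim assms(2) by (intro mult_right_mono) auto
    then show ?case using elim(1) by linarith
  qed
qed

lemma definable_slope_ge:
  assumes "definable_fun g"
  shows "definable (\<lambda>z. slope_ge g (fst z) (snd z))"
proof -
  have "definable (\<lambda>z :: real \<times> real. \<exists>b. b > fst z \<and>
      (\<forall>v. v > fst z \<longrightarrow> v < b \<longrightarrow> snd z * (v - fst z) \<le> g v - g (fst z)))"
    by (intro definable_intros definable_fun_comp[OF assms])
  then show ?thesis unfolding slope_ge_def eventually_at_right_field by simp
qed

lemma slope_ge_imp_increment_ge:
  assumes "s \<le> t" "continuous_on {s..t} g" "\<And>u. s \<le> u \<Longrightarrow> u < t \<Longrightarrow> slope_ge g u c"
  shows "c * (t - s) \<le> g t - g s"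
proof -
  have "g s - c * s \<le> g t - c * t"
  proof (rule increasing_of_locally_increasing_right[OF assms(1)])
    show "continuous_on {s..t} (\<lambda>u. g u - c * u)" by (intro continuous_intros assms)
    fix u assume "s \<le> u" "u < t"
    from assms(3)[OF this] show "\<forall>\<^sub>F v in at_right u. g u - c * u \<le> g v - c * v"
      unfolding slope_ge_def by (rule eventually_mono) (simp add: algebra_simps)
  qed
  then show ?thesis by (simp add: algebra_simps)
qed

text \<open>Negating \<open>slope_ge\<close> says a priori only that small difference quotients
  occur arbitrarily close to \<open>u\<close>. By the dichotomy for definable predicates they then
  occur at all \<open>v\<close> close to \<open>u\<close> on the right, so that
  \<open>c * u - g u\<close> is locally increasing.\<close>

lemma not_slope_ge_imp_increment_le:
  assumes g: "definable_fun g"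
    and "s \<le> t" "continuous_on {s..t} g" "\<And>u. s \<le> u \<Longrightarrow> u < t \<Longrightarrow> \<not> slope_ge g u c"
  shows "g t - g s \<le> c * (t - s)"
proof -
  have "c * s - g s \<le> c * t - g t"
  proof (rule increasing_of_locally_increasing_right[OF assms(2)])
    show "continuous_on {s..t} (\<lambda>u. c * u - g u)" by (intro continuous_intros assms)
    fix u assume "s \<le> u" "u < t"
    have "definable (\<lambda>v. c * (v - u) \<le> g v - g u)"
      by (intro definable_intros definable_fun_comp[OF g])
    with assms(4)[OF \<open>s \<le> u\<close> \<open>u < t\<close>] have "\<forall>\<^sub>F v in at_right u. \<not> c * (v - u) \<le> g v - g u"
      unfolding slope_ge_def using definable_eventually_at_right by blast
    then show "\<forall>\<^sub>F v in at_right u. c * u - g u \<le> c * v - g v"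
      by (rule eventually_mono) (simp add: algebra_simps)
  qed
  then show ?thesis by (simp add: algebra_simps)
qed

text \<open>The increments are controlled between any two points near \<open>t\<close>, so
  \<open>t\<close> may serve as left or as right end point; this turns one-sided slope information
  into a two-sided derivative.\<close>

lemma has_real_derivative_of_slope_bounds:
  assumes "\<And>\<delta>. \<delta> > 0 \<Longrightarrow> \<exists>\<eta>>0. \<forall>s s'. t - \<eta> < s \<longrightarrow> s \<le> s' \<longrightarrow> s' < t + \<eta> \<longrightarrow>
      (D - \<delta>) * (s' - s) \<le> g s' - g s \<and> g s' - g s \<le> (D + \<delta>) * (s' - s)"
  shows "(g has_real_derivative D) (at t)"
  unfolding DERIV_def
proof (rule LIM_I)
  fix r :: real assume "r > 0"
  then obtain \<eta> where \<eta>: "\<eta> > 0" "\<And>s s'. t - \<eta> < s \<Longrightarrow> s \<le> s' \<Longrightarrow> s' < t + \<eta> \<Longrightarrow>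
      (D - r / 2) * (s' - s) \<le> g s' - g s \<and> g s' - g s \<le> (D + r / 2) * (s' - s)"
    using assms[of "r / 2"] by auto
  have "norm ((g (t + h) - g t) / h - D) < r" if "h \<noteq> 0" "norm (h - 0) < \<eta>" for h
  proof -
    have "D - r / 2 \<le> (g (t + h) - g t) / h \<and> (g (t + h) - g t) / h \<le> D + r / 2"
    proof (cases "h > 0")
      case True
      then show ?thesis using \<eta>(2)[of t "t + h"] that by (simp add: field_simps)
    next
      case False
      then show ?thesis using \<eta>(2)[of "t + h" t] that by (simp add: field_simps)
    qed
    then show ?thesis using \<open>r > 0\<close> unfolding real_norm_def by linarith
  qed
  then show "\<exists>s>0. \<forall>h. h \<noteq> 0 \<and> norm (h - 0) < s \<longrightarrow> norm ((g (t + h) - g t) / h - D) < r"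
    using \<eta>(1) by blast
qed

text \<open>
  A right derivative \<open>+\<infinity>\<close> throughout an interval would make \<open>t \<mapsto> g t - k t\<close> increasing there for
  every \<open>k\<close>, and similarly for \<open>-\<infinity>\<close>.
\<close>

lemma definable_eventually_finite_slope:
  assumes g: "definable_fun g"
  shows "\<forall>\<^sub>F t in at_right c. (\<exists>k. slope_ge g t k) \<and> (\<exists>k. \<not> slope_ge g t k)"
proof -
  note slope = definable_comp2[OF definable_slope_ge[OF g]]
  obtain b where b: "b > c" "\<And>t. c < t \<Longrightarrow> t < b \<Longrightarrow> isCont g t"
    using definable_eventually_isCont[OF g, of c] unfolding eventually_at_right_field by blast
  have cont: "continuous_on {s..t} g" if "c < s" "t < b" for s t
    using b(2) that by (intro continuous_at_imp_continuous_on) auto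
  have two: "\<exists>s t. c < s \<and> s < t \<and> t < b \<and> (\<forall>u. s \<le> u \<longrightarrow> u < t \<longrightarrow> P u)"
    if P: "\<forall>\<^sub>F t in at_right c. P t" for P
  proof -
    obtain b' where b': "b' > c" "\<And>t. c < t \<Longrightarrow> t < b' \<Longrightarrow> P t"
      using P unfolding eventually_at_right_field by blast
    obtain t where t: "c < t" "t < min b b'" using dense[of c "min b b'"] b(1) b'(1) by auto
    obtain s where "c < s" "s < t" using dense t by blast
    then show ?thesis using t b' by (intro exI[of _ s] exI[of _ t]) auto
  qed
  have "definable (\<lambda>t. \<exists>k. slope_ge g t k)" "definable (\<lambda>t. \<exists>k. \<not> slope_ge g t k)"
    by (intro definable_intros slope)+
  from this[THEN definable_eventually_at_right, of c]
  consider "\<forall>\<^sub>F t in at_right c. \<forall>k. \<not> slope_ge g t k" | "\<forall>\<^sub>F t in at_right c. \<forall>k. slope_ge g t k"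
    | "\<forall>\<^sub>F t in at_right c. \<exists>k. slope_ge g t k" "\<forall>\<^sub>F t in at_right c. \<exists>k. \<not> slope_ge g t k"
    by auto
  then show ?thesis
  proof cases
    case 1
    obtain s t where st: "c < s" "s < t" "t < b"
      "\<And>u k. s \<le> u \<Longrightarrow> u < t \<Longrightarrow> \<not> slope_ge g u k"
      using two[OF 1] by blast
    have "g t - g s \<le> k * (t - s)" for k
      using st by (intro not_slope_ge_imp_increment_le[OF g] cont) auto
    \<comment> \<open>A \<open>k\<close> one below the mean slope violates the bound.\<close>
    from this[of "(g t - g s) / (t - s) - 1"] show ?thesis
      using st(2) left_diff_distrib[of "(g t - g s) / (t - s)" 1 "t - s"] by simp
  next
    case 2
    obtain s t where st: "c < s" "s < t" "t < b"
      "\<And>u k. s \<le> u \<Longrightarrow> u < t \<Longrightarrow> slope_ge g u k"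
      using two[OF 2] by blast
    have "k * (t - s) \<le> g t - g s" for k
      using st by (intro slope_ge_imp_increment_ge cont) auto
    from this[of "(g t - g s) / (t - s) + 1"] show ?thesis
      using st(2) distrib_right[of "(g t - g s) / (t - s)" 1 "t - s"] by simp
  next
    case 3
    then show ?thesis by (rule eventually_conj)
  qed
qed

text \<open>
  The derivative is the right derivative, wherever the latter is finite on a neighbourhood and
  continuous.
\<close>

lemma definable_eventually_differentiable:
  fixes g :: "real \<Rightarrow> real"
  assumes g: "definable_fun g"
  obtains d where "definable_fun d" "\<forall>\<^sub>F t in at_right c. (g has_real_derivative d t) (at t)"
proof -
  note slope = definable_comp2[OF definable_slope_ge[OF g]]
  define finite_slope where
    "finite_slope t \<longleftrightarrow> (\<exists>k. slope_ge g t k) \<and> (\<exists>k. \<not> slope_ge g t k)" for t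
  \<comment> \<open>The default value \<open>0\<close> keeps \<open>A t\<close> non-empty and
    bounded above for every \<open>t\<close>, as \<open>definable_fun_Sup\<close> requires; close to
    \<open>c\<close> on the right the slope is finite and the default does not occur.\<close>
  define A where "A t = {k. finite_slope t \<and> slope_ge g t k \<or> \<not> finite_slope t \<and> k = 0}" for t
  define d where "d t = Sup (A t)" for t
  have ne: "A t \<noteq> {}" for t by (auto simp: A_def finite_slope_def)
  have bdd: "bdd_above (A t)" for t
  proof (cases "finite_slope t")
    case True
    then obtain k where "\<not> slope_ge g t k" by (auto simp: finite_slope_def)
    then have "k' \<le> k" if "slope_ge g t k'" for k'
      using slope_ge_mono[OF that, of k] by linarith
    then show ?thesis using True by (auto simp: A_def intro!: bdd_aboveI[of _ k])
  qed (auto simp: A_def)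
  have "definable_fun d"
    unfolding d_def
  proof (rule definable_fun_Sup[OF _ ne bdd])
    show "definable (\<lambda>z. snd z \<in> A (fst z))"
      unfolding A_def finite_slope_def mem_Collect_eq by (intro definable_intros slope)
  qed
  obtain b where b: "b > c"
    "\<And>t. c < t \<Longrightarrow> t < b \<Longrightarrow> isCont g t \<and> isCont d t \<and> finite_slope t"
    using eventually_conj[OF definable_eventually_isCont[OF g, of c]
        eventually_conj[OF definable_eventually_isCont[OF \<open>definable_fun d\<close>, of c]
          definable_eventually_finite_slope[OF g, of c]]]
    unfolding eventually_at_right_field finite_slope_def by blast
  have "(g has_real_derivative d t) (at t)" if t: "c < t" "t < b" for t
  proof (rule has_real_derivative_of_slope_bounds)
    fix \<delta> :: real assume "\<delta> > 0"
    then obtain \<eta>0 where \<eta>0: "\<eta>0 > 0" "\<And>u. dist u t < \<eta>0 \<Longrightarrow> dist (d u) (d t) < \<delta>"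
      using b(2)[OF t] unfolding continuous_at_eps_delta by meson
    define \<eta> where "\<eta> = min \<eta>0 (min (t - c) (b - t))"
    have "(d t - \<delta>) * (s' - s) \<le> g s' - g s \<and> g s' - g s \<le> (d t + \<delta>) * (s' - s)"
      if s: "t - \<eta> < s" "s \<le> s'" "s' < t + \<eta>" for s s'
    proof
      have cont: "continuous_on {s..s'} g"
        using b(2) s by (intro continuous_at_imp_continuous_on) (auto simp: \<eta>_def)
      have u: "finite_slope u" "\<bar>d u - d t\<bar> < \<delta>" if "s \<le> u" "u < s'" for u
        using b(2)[of u] \<eta>0(2)[of u] that s by (auto simp: \<eta>_def dist_real_def)
      \<comment> \<open>Since \<open>d u\<close> is the supremum of the slopes admissible at
        \<open>u\<close>, a number below it is dominated by an admissible slope, and a number above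
        it is not admissible.\<close>
      have "slope_ge g u (d t - \<delta>)" if "s \<le> u" "u < s'" for u
      proof -
        have "d t - \<delta> < Sup (A u)" using u(2)[OF that] by (simp add: d_def)
        then obtain k where "k \<in> A u" "d t - \<delta> < k" using less_cSup_iff[OF ne bdd] by blast
        then show ?thesis using u(1)[OF that] slope_ge_mono by (auto simp: A_def)
      qed
      then show "(d t - \<delta>) * (s' - s) \<le> g s' - g s"
        by (intro slope_ge_imp_increment_ge s cont) auto
      have "\<not> slope_ge g u (d t + \<delta>)" if "s \<le> u" "u < s'" for u
      proof
        assume "slope_ge g u (d t + \<delta>)"
        then have "d t + \<delta> \<in> A u" using u(1)[OF that] by (simp add: A_def)
        then have "d t + \<delta> \<le> d u" unfolding d_def by (rule cSup_upper[OF _ bdd])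
        then show False using u(2)[OF that] by simp
      qed
      then show "g s' - g s \<le> (d t + \<delta>) * (s' - s)"
        by (intro not_slope_ge_imp_increment_le[OF g] s cont) auto
    qed
    moreover have "\<eta> > 0" using \<eta>0 t by (simp add: \<eta>_def)
    ultimately show "\<exists>\<eta>>0. \<forall>s s'. t - \<eta> < s \<longrightarrow> s \<le> s' \<longrightarrow> s' < t + \<eta> \<longrightarrow>
        (d t - \<delta>) * (s' - s) \<le> g s' - g s \<and> g s' - g s \<le> (d t + \<delta>) * (s' - s)"
      by blast
  qed
  then have "\<forall>\<^sub>F t in at_right c. (g has_real_derivative d t) (at t)"
    unfolding eventually_at_right_field using b(1) by blast
  with \<open>definable_fun d\<close> show thesis by (rule that)
qed

end

section \<open>Flat functions and minorants in the class Phi\<close>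

text \<open>The derivative is an existential witness, so the rules for sums and products are
  inductions that never compute \<open>deriv\<close>.\<close>

primrec Ck :: "nat \<Rightarrow> (real \<Rightarrow> real) \<Rightarrow> bool" where
  "Ck 0 f \<longleftrightarrow> continuous_on UNIV f"
| "Ck (Suc p) f \<longleftrightarrow> (\<exists>f'. (\<forall>t. (f has_real_derivative f' t) (at t)) \<and> Ck p f')"

text \<open>
  The conditions on derivatives in the definition of \<open>\<Phi>\<^sub>p\<close>, localized to an open set \<open>U\<close> containing
  \<open>0\<close> and in a recursive form for which the chain rule is an induction.
\<close>

primrec flat :: "nat \<Rightarrow> real set \<Rightarrow> (real \<Rightarrow> real) \<Rightarrow> bool" where
  "flat 0 U f \<longleftrightarrow> f 0 = 0 \<and> continuous_on U f"
| "flat (Suc p) U f \<longleftrightarrow>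
     f 0 = 0 \<and> (\<exists>f'. (\<forall>t\<in>U. (f has_real_derivative f' t) (at t)) \<and> flat p U f')"

lemma Ck_SucI: "(\<And>t. (f has_real_derivative f' t) (at t)) \<Longrightarrow> Ck p f' \<Longrightarrow> Ck (Suc p) f"
  by auto

lemma flat_SucI:
  "f 0 = 0 \<Longrightarrow> (\<And>t. t \<in> U \<Longrightarrow> (f has_real_derivative f' t) (at t)) \<Longrightarrow> flat p U f' \<Longrightarrow> flat (Suc p) U f"
  by auto

lemma Ck_SucD: "Ck (Suc p) f \<Longrightarrow> Ck p f"
proof (induction p arbitrary: f)
  case 0
  then obtain f' where "\<And>t. (f has_real_derivative f' t) (at t)" unfolding Ck.simps by blast
  then show ?case by (auto intro!: continuous_at_imp_continuous_on DERIV_isCont)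
qed (auto simp only: Ck.simps)

lemma flat_SucD: "flat (Suc p) U f \<Longrightarrow> flat p U f"
proof (induction p arbitrary: f)
  case 0
  then obtain f' where "f 0 = 0" "\<And>t. t \<in> U \<Longrightarrow> (f has_real_derivative f' t) (at t)"
    unfolding flat.simps by blast
  then show ?case by (auto intro!: continuous_at_imp_continuous_on DERIV_isCont)
qed (auto simp only: flat.simps)

lemma flat_subset: "flat p U f \<Longrightarrow> V \<subseteq> U \<Longrightarrow> flat p V f"
  by (induction p arbitrary: f) (auto intro: continuous_on_subset)

lemma flat_imp_continuous: "flat p U f \<Longrightarrow> continuous_on U f"
  by (induction p) (auto simp only: flat.simps(1) dest: flat_SucD)

lemma Ck_const: "Ck p (\<lambda>t. c)"
  by (induction p arbitrary: c) (auto intro!: exI[of _ "\<lambda>t. 0"])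

lemma Ck_id: "Ck p (\<lambda>t. t)"
  by (cases p) (auto intro!: exI[of _ "\<lambda>t. 1"] Ck_const)

lemma Ck_add: "Ck p f \<Longrightarrow> Ck p g \<Longrightarrow> Ck p (\<lambda>t. f t + g t)"
proof (induction p arbitrary: f g)
  case (Suc p)
  obtain f' where f': "\<And>t. (f has_real_derivative f' t) (at t)" "Ck p f'"
    using Suc.prems(1) unfolding Ck.simps by blast
  obtain g' where g': "\<And>t. (g has_real_derivative g' t) (at t)" "Ck p g'"
    using Suc.prems(2) unfolding Ck.simps by blast
  show ?case by (rule Ck_SucI[OF DERIV_add[OF f'(1) g'(1)] Suc.IH[OF f'(2) g'(2)]])
qed (auto intro: continuous_intros)

lemma Ck_mult: "Ck p f \<Longrightarrow> Ck p g \<Longrightarrow> Ck p (\<lambda>t. f t * g t)"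
proof (induction p arbitrary: f g)
  case (Suc p)
  obtain f' where f': "\<And>t. (f has_real_derivative f' t) (at t)" "Ck p f'"
    using Suc.prems(1) unfolding Ck.simps by blast
  obtain g' where g': "\<And>t. (g has_real_derivative g' t) (at t)" "Ck p g'"
    using Suc.prems(2) unfolding Ck.simps by blast
  show ?case
    by (rule Ck_SucI[OF DERIV_mult[OF f'(1) g'(1)]])
      (intro f' g' Ck_add Suc.IH Suc.prems[THEN Ck_SucD])
qed (auto intro: continuous_intros)

lemma flat_add: "flat p U f \<Longrightarrow> flat p U g \<Longrightarrow> flat p U (\<lambda>t. f t + g t)"
proof (induction p arbitrary: f g)
  case (Suc p)
  obtain f' where f': "f 0 = 0" "\<And>t. t \<in> U \<Longrightarrow> (f has_real_derivative f' t) (at t)" "flat p U f'"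
    using Suc.prems(1) unfolding flat.simps by blast
  obtain g' where g': "g 0 = 0" "\<And>t. t \<in> U \<Longrightarrow> (g has_real_derivative g' t) (at t)" "flat p U g'"
    using Suc.prems(2) unfolding flat.simps by blast
  show ?case by (rule flat_SucI[OF _ DERIV_add[OF f'(2) g'(2)] Suc.IH[OF f'(3) g'(3)]])
      (simp_all add: f' g')
qed (auto intro: continuous_intros)

text \<open>The second factor may be non-zero at \<open>0\<close>; this covers the inner derivative
  in the chain rule.\<close>

lemma flat_mult_Ck: "flat p UNIV f \<Longrightarrow> Ck p g \<Longrightarrow> flat p UNIV (\<lambda>t. f t * g t)"
proof (induction p arbitrary: f g)
  case (Suc p)
  obtain f' where f': "f 0 = 0" "\<And>t. t \<in> UNIV \<Longrightarrow> (f has_real_derivative f' t) (at t)" "flat p UNIV f'"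
    using Suc.prems(1) unfolding flat.simps by blast
  obtain g' where g': "\<And>t. (g has_real_derivative g' t) (at t)" "Ck p g'"
    using Suc.prems(2) unfolding Ck.simps by blast
  have "flat p UNIV (\<lambda>t. f' t * g t + f t * g' t)"
    by (intro flat_add Suc.IH f' g' flat_SucD[OF Suc.prems(1)] Ck_SucD[OF Suc.prems(2)])
  moreover have "((\<lambda>t. f t * g t) has_real_derivative f' t * g t + f t * g' t) (at t)" for t
    using DERIV_mult[OF f'(2) g'(1), of t] by (simp add: mult.commute)
  ultimately show ?case using f'(1) by (intro flat_SucI) auto
qed (auto intro: continuous_intros)

text \<open>The range condition trades flatness on a neighbourhood \<open>U\<close> for flatness on
  the whole line, and \<open>u 0 = 0\<close> preserves the vanishing at \<open>0\<close>.\<close>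

lemma flat_compose:
  "flat p U f \<Longrightarrow> Ck p u \<Longrightarrow> range u \<subseteq> U \<Longrightarrow> u 0 = 0 \<Longrightarrow> flat p UNIV (\<lambda>t. f (u t))"
proof (induction p arbitrary: f)
  case 0
  then show ?case using continuous_on_compose2[of U f UNIV u] by auto
next
  case (Suc p)
  obtain f' where f': "f 0 = 0" "\<And>t. t \<in> U \<Longrightarrow> (f has_real_derivative f' t) (at t)" "flat p U f'"
    using Suc.prems(1) unfolding flat.simps by blast
  obtain u' where u': "\<And>t. (u has_real_derivative u' t) (at t)" "Ck p u'"
    using Suc.prems(2) unfolding Ck.simps by blast
  have "((\<lambda>t. f (u t)) has_real_derivative f' (u t) * u' t) (at t)" for t
    using f'(2)[of "u t"] u'(1)[of t] Suc.prems(3) by (intro DERIV_chain2) auto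
  moreover have "flat p UNIV (\<lambda>t. f' (u t) * u' t)"
    using Suc.IH[OF f'(3) Ck_SucD[OF Suc.prems(2)] Suc.prems(3,4)] u'(2) by (rule flat_mult_Ck)
  ultimately show ?case using f'(1) Suc.prems(4) by (intro flat_SucI) auto
qed

lemma flat_uminus: "flat p UNIV f \<Longrightarrow> flat p UNIV (\<lambda>t. - f t)"
  using flat_mult_Ck[OF _ Ck_const, of p f "-1"] by simp

lemma flat_compose_uminus: "flat p UNIV f \<Longrightarrow> flat p UNIV (\<lambda>t. f (- t))"
  using Ck_mult[OF Ck_const Ck_id, of p "-1"] by (intro flat_compose[where u = uminus]) auto

text \<open>On the whole line the witness is determined, \<open>deriv f = f'\<close> as functions,
  so iterated derivatives shift by one at each step of the induction.\<close>

lemma flat_imp_of_class_C: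
  "flat p UNIV f \<Longrightarrow> of_class_C p f \<and> (\<forall>k\<le>p. (deriv ^^ k) f 0 = 0)"
proof (induction p arbitrary: f)
  case (Suc p)
  obtain f' where f': "\<And>t. (f has_real_derivative f' t) (at t)" "flat p UNIV f'"
    using Suc.prems unfolding flat.simps by blast
  have "deriv f = f'" using f'(1) DERIV_imp_deriv by blast
  then have pow: "(deriv ^^ Suc k) f = (deriv ^^ k) f'" for k
    by (simp only: funpow_Suc_right o_def)
  have IH: "of_class_C p f'" "\<And>k. k \<le> p \<Longrightarrow> (deriv ^^ k) f' 0 = 0"
    using Suc.IH[OF f'(2)] by auto
  have "(deriv ^^ k) f field_differentiable at t" if "k < Suc p" for k t
  proof (cases k)
    case 0
    then show ?thesis using f'(1) field_differentiable_def by auto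
  next
    case (Suc j)
    then show ?thesis using IH(1) that unfolding Suc pow of_class_C_def by simp
  qed
  moreover have "continuous_on UNIV ((deriv ^^ Suc p) f)"
    using IH(1) unfolding pow of_class_C_def by simp
  moreover have "(deriv ^^ k) f 0 = 0" if "k \<le> Suc p" for k
  proof (cases k)
    case 0
    then show ?thesis using Suc.prems by simp
  next
    case (Suc j)
    then show ?thesis using IH(2) that unfolding Suc pow by simp
  qed
  ultimately show ?case by (simp add: of_class_C_def)
qed (simp add: of_class_C_def)

lemma has_real_derivative_max_power:
  "((\<lambda>t. max 0 (t - M) ^ Suc (Suc n)) has_real_derivative
     real (Suc (Suc n)) * max 0 (t - M) ^ Suc n) (at t)"
proof (cases t M rule: linorder_cases)
  case less
  have "((\<lambda>t. 0) has_real_derivative real (Suc (Suc n)) * max 0 (t - M) ^ Suc n) (at t)"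
    using less by simp
  then show ?thesis
    by (rule has_field_derivative_transform_within_open[of _ _ _ "{..<M}"]) (use less in auto)
next
  case equal
  show ?thesis
    unfolding CARAT_DERIV
  proof (intro exI conjI allI)
    \<comment> \<open>At the kink the Caratheodory slope function is explicit; it is continuous and
      vanishes at \<open>M\<close>.\<close>
    show "max 0 (z - M) ^ Suc (Suc n) - max 0 (t - M) ^ Suc (Suc n) =
        max 0 (z - M) ^ Suc n * (z - t)" for z
      using equal by (auto simp: max_def)
    show "isCont (\<lambda>z. max 0 (z - M) ^ Suc n) t" by (intro continuous_intros)
  qed (use equal in auto)
next
  case greater
  have "((\<lambda>t. (t - M) ^ Suc (Suc n)) has_real_derivative
      real (Suc (Suc n)) * max 0 (t - M) ^ Suc n) (at t)"
    using greater by (auto intro!: derivative_eq_intros simp del: power_Suc)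
  then show ?thesis
    by (rule has_field_derivative_transform_within_open[of _ _ _ "{M<..}"]) (use greater in auto)
qed

text \<open>The exponent exceeds the order by one because each derivative lowers it by one and the
  last derivative must still be continuous; \<open>M \<ge> 0\<close> puts \<open>0\<close> where the
  function vanishes.\<close>

lemma flat_max_power:
  assumes "M \<ge> 0"
  shows "flat p UNIV (\<lambda>t. max 0 (t - M) ^ Suc p)"
proof (induction p)
  case 0
  then show ?case using assms by (auto intro!: continuous_intros)
next
  case (Suc p)
  have "flat p UNIV (\<lambda>t. real (Suc (Suc p)) * max 0 (t - M) ^ Suc p)"
    using flat_mult_Ck[OF Suc Ck_const] by (simp only: mult.commute)
  then show ?case
    using has_real_derivative_max_power assms by (intro flat_SucI) auto
qed

text \<open>The derivative is minus \<open>t\<close> times the cube of the function itself, hence as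
  smooth as the function is already known to be; the order rises by one.\<close>

lemma Ck_inverse_sqrt: "Ck p (\<lambda>t. 1 / sqrt (1 + t\<^sup>2))"
proof (induction p)
  case 0
  have "sqrt (1 + t\<^sup>2) \<noteq> 0" for t :: real by (simp add: add_nonneg_eq_0_iff)
  then show ?case by (auto intro!: continuous_intros)
next
  case (Suc p)
  let ?w = "\<lambda>t :: real. 1 / sqrt (1 + t\<^sup>2)"
  have "(?w has_real_derivative (-1) * (t * (?w t * (?w t * ?w t)))) (at t)" for t
  proof -
    have pos: "1 + t\<^sup>2 > 0" by (simp add: add_pos_nonneg)
    then show ?thesis
      by (auto intro!: derivative_eq_intros simp: field_simps power2_eq_square)
  qed
  moreover have "Ck p (\<lambda>t. (-1) * (t * (?w t * (?w t * ?w t))))"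
    by (intro Ck_mult Suc Ck_const Ck_id)
  ultimately show ?case by (rule Ck_SucI)
qed

text \<open>Otherwise integration would give \<open>\<phi> t \<ge> r t\<^sup>p\<^sup>+\<^sup>1 / (p + 1)\<close>.\<close>

lemma vanishing_order_derivative_le:
  fixes \<phi> d :: "real \<Rightarrow> real"
  assumes deriv: "\<forall>\<^sub>F t in at_right 0. (\<phi> has_real_derivative d t) (at t)"
    and lim: "((\<lambda>t. \<phi> t / t ^ Suc p) \<longlongrightarrow> 0) (at_right 0)"
    and "r > 0"
  shows "\<not> (\<forall>\<^sub>F t in at_right 0. r * t ^ p < d t)"
proof
  assume slope: "\<forall>\<^sub>F t in at_right 0. r * t ^ p < d t"
  \<comment> \<open>\<open>r' * t ^ Suc p\<close> is the antiderivative of \<open>r * t ^ p\<close>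
    that vanishes at \<open>0\<close>.\<close>
  define r' where "r' = r / real (Suc p)"
  have "r' > 0" using \<open>r > 0\<close> by (simp add: r'_def)
  then have "\<forall>\<^sub>F t in at_right 0. \<phi> t / t ^ Suc p < r'"
    using lim by (rule order_tendstoD(2)[rotated])
  with deriv slope have "\<forall>\<^sub>F t in at_right 0. (\<phi> has_real_derivative d t) (at t) \<and>
      r * t ^ p < d t \<and> \<phi> t / t ^ Suc p < r'"
    by (simp add: eventually_conj_iff)
  then obtain b where b: "b > 0" "\<And>t. 0 < t \<Longrightarrow> t < b \<Longrightarrow>
      (\<phi> has_real_derivative d t) (at t) \<and> r * t ^ p < d t \<and> \<phi> t / t ^ Suc p < r'"
    unfolding eventually_at_right_field by auto
  \<comment> \<open>This difference is nondecreasing and tends to \<open>0\<close> at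
    \<open>0\<close>, hence would be non-negative at \<open>t\<close>; the choice of
    \<open>b\<close> makes it negative there.\<close>
  define \<psi> where "\<psi> t = \<phi> t - r' * t ^ Suc p" for t
  define t where "t = b / 2"
  have t: "0 < t" "t < b" using b(1) by (auto simp: t_def)
  have mono: "\<psi> s \<le> \<psi> t" if s: "0 < s" "s < t" for s
  proof (rule DERIV_nonneg_imp_nondecreasing[where f = \<psi> and a = s and b = t])
    show "s \<le> t" using s by simp
    fix x assume x: "s \<le> x" "x \<le> t"
    have "(\<psi> has_real_derivative d x - r' * (real (Suc p) * x ^ p)) (at x)"
      unfolding \<psi>_def using b(2)[of x] s t x
      by (auto intro!: derivative_eq_intros simp del: power_Suc)
    moreover have "r' * (real (Suc p) * x ^ p) = r * x ^ p" by (simp add: r'_def)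
    ultimately have "(\<psi> has_real_derivative d x - r * x ^ p) (at x)"
      by (simp only:)
    moreover have "0 \<le> d x - r * x ^ p" using b(2)[of x] s t x by simp
    ultimately show "\<exists>y. (\<psi> has_real_derivative y) (at x) \<and> 0 \<le> y" by blast
  qed
  have power: "((\<lambda>s :: real. s ^ Suc p) \<longlongrightarrow> 0) (at_right 0)"
    by (rule tendsto_eq_intros refl | simp)+
  have "((\<lambda>s. \<phi> s / s ^ Suc p * s ^ Suc p - r' * s ^ Suc p) \<longlongrightarrow> 0 * 0 - r' * 0) (at_right 0)"
    by (intro tendsto_intros lim power)
  then have "(\<psi> \<longlongrightarrow> 0 * 0 - r' * 0) (at_right 0)"
    by (rule Lim_transform_eventually) (simp add: \<psi>_def eventually_at_filter)
  then have "(\<psi> \<longlongrightarrow> 0) (at_right 0)" by simp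
  moreover have "\<forall>\<^sub>F s in at_right 0. \<psi> s \<le> \<psi> t"
    unfolding eventually_at_right_field using mono t by blast
  ultimately have "0 \<le> \<psi> t" by (intro tendsto_upperbound) auto
  moreover have "\<phi> t < r' * t ^ Suc p" using b(2)[OF t] t by (simp add: divide_less_eq)
  ultimately show False by (simp add: \<psi>_def)
qed

section \<open>Smoothness of definable functions vanishing to high order\<close>

context o_minimal_structure
begin

text \<open>Differentiation lowers the order of vanishing by one, so the induction on
  \<open>p\<close> applies to the derivative. To the left of \<open>0\<close> the function is
  \<open>0\<close>, to the right definability provides the derivative, and at \<open>0\<close>
  itself the quotient \<open>\<phi> s / s\<close> tends to \<open>0\<close> by the order of
  vanishing.\<close>

lemma definable_flat:
  fixes \<phi> :: "real \<Rightarrow> real"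
  assumes "definable_fun \<phi>" "\<And>t. t \<le> 0 \<Longrightarrow> \<phi> t = 0"
    and "((\<lambda>t. \<phi> t / t ^ p) \<longlongrightarrow> 0) (at_right 0)"
  shows "\<exists>\<epsilon>>0. flat p {-\<epsilon><..<\<epsilon>} \<phi>"
  using assms
proof (induction p arbitrary: \<phi>)
  case 0
  obtain \<epsilon> where \<epsilon>: "\<epsilon> > 0" "\<And>t. 0 < t \<Longrightarrow> t < \<epsilon> \<Longrightarrow> isCont \<phi> t"
    using definable_eventually_isCont[OF 0(1), of 0] unfolding eventually_at_right_field by auto
  have "isCont \<phi> t" if "t < \<epsilon>" for t
  proof (cases t "0 :: real" rule: linorder_cases)
    case less
    have "\<forall>\<^sub>F s in nhds t. \<phi> s = 0"
      using eventually_nhds_in_open[of "{..<0}" t] less 0(2)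
      by (auto elim: eventually_mono)
    then show ?thesis using isCont_cong[of \<phi> "\<lambda>s. 0" t] by simp
  next
    case equal
    have "\<forall>\<^sub>F s in at_left 0. \<phi> s = 0"
      by (auto simp: eventually_at_filter 0(2))
    then have "(\<phi> \<longlongrightarrow> 0) (at_left 0)" by (rule tendsto_eventually)
    then have "(\<phi> \<longlongrightarrow> 0) (at 0)" using 0(3) by (simp add: filterlim_split_at)
    then show ?thesis using equal 0(2)[of 0] by (simp add: isCont_def)
  qed (use \<epsilon>(2) that in auto)
  then have "flat 0 {-\<epsilon><..<\<epsilon>} \<phi>"
    using 0(2)[of 0] by (auto intro!: continuous_at_imp_continuous_on)
  then show ?case using \<epsilon>(1) by blast
next
  case (Suc p)
  obtain d where d: "definable_fun d" "\<forall>\<^sub>F t in at_right 0. (\<phi> has_real_derivative d t) (at t)"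
    using definable_eventually_differentiable[OF Suc.prems(1)] by blast
  \<comment> \<open>The function \<open>d\<close> is known to be the derivative only to the right of
    \<open>0\<close>; cutting it off restores the hypothesis that the function vanishes on
    non-positive arguments.\<close>
  define \<phi>' where "\<phi>' t = (if 0 < t then d t else 0)" for t
  have \<phi>': "definable_fun \<phi>'"
    unfolding \<phi>'_def by (intro definable_intros definable_fun_comp[OF d(1)])
  have zero: "\<phi>' t = 0" if "t \<le> 0" for t
    using that by (simp add: \<phi>'_def)
  have "((\<lambda>t. \<phi>' t / t ^ p) \<longlongrightarrow> 0) (at_right 0)"
  proof (rule tendstoI)
    fix r :: real assume "r > 0"
    \<comment> \<open>Leaves room below \<open>r\<close>: the dichotomy yields only the weak bound
      \<open>\<bar>d t\<bar> \<le> r' * t ^ p\<close>, whereas a strict one is required.\<close>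
    define r' where "r' = r / 2"
    have "r' > 0" "r' < r" using \<open>r > 0\<close> by (auto simp: r'_def)
    have "definable (\<lambda>t. r' * t ^ p < d t)" "definable (\<lambda>t. r' * t ^ p < - d t)"
      by (intro definable_intros definable_fun_comp[OF d(1)])+
    note this[THEN definable_eventually_at_right, of 0]
    moreover have "\<not> (\<forall>\<^sub>F t in at_right 0. r' * t ^ p < d t)"
      using d(2) Suc.prems(3) \<open>r' > 0\<close> by (rule vanishing_order_derivative_le)
    moreover have "\<not> (\<forall>\<^sub>F t in at_right 0. r' * t ^ p < - d t)"
    proof (rule vanishing_order_derivative_le[where \<phi> = "\<lambda>t. - \<phi> t"])
      show "\<forall>\<^sub>F t in at_right 0. ((\<lambda>t. - \<phi> t) has_real_derivative - d t) (at t)"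
        using d(2) by eventually_elim (rule DERIV_minus)
      show "((\<lambda>t. - \<phi> t / t ^ Suc p) \<longlongrightarrow> 0) (at_right 0)"
        using tendsto_minus[OF Suc.prems(3)] by simp
    qed fact
    ultimately have "\<forall>\<^sub>F t in at_right 0. \<not> r' * t ^ p < d t \<and> \<not> r' * t ^ p < - d t"
      by (simp add: eventually_conj_iff)
    moreover have "\<forall>\<^sub>F t in at_right (0 :: real). 0 < t" by (simp add: eventually_at_right_less)
    ultimately show "\<forall>\<^sub>F t in at_right 0. dist (\<phi>' t / t ^ p) 0 < r"
    proof eventually_elim
      case (elim t)
      then have "t ^ p > 0" "\<bar>d t\<bar> \<le> r' * t ^ p" by auto
      then have "\<bar>d t\<bar> / t ^ p \<le> r'" by (simp add: divide_le_eq)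
      then show ?case using elim \<open>r' < r\<close> by (simp add: \<phi>'_def dist_real_def)
    qed
  qed
  from Suc.IH[OF \<phi>' zero this]
  obtain \<epsilon>1 where \<epsilon>1: "\<epsilon>1 > 0" "flat p {-\<epsilon>1<..<\<epsilon>1} \<phi>'"
    by blast
  obtain \<epsilon>2 where \<epsilon>2: "\<epsilon>2 > 0" "\<And>t. 0 < t \<Longrightarrow> t < \<epsilon>2 \<Longrightarrow> (\<phi> has_real_derivative d t) (at t)"
    using d(2) unfolding eventually_at_right_field by auto
  define \<epsilon> where "\<epsilon> = min \<epsilon>1 \<epsilon>2"
  have "(\<phi> has_real_derivative \<phi>' t) (at t)" if "t < \<epsilon>" for t
  proof (cases t "0 :: real" rule: linorder_cases)
    case less
    have "((\<lambda>t. 0) has_real_derivative \<phi>' t) (at t)" using less by (simp add: \<phi>'_def)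
    then show ?thesis
      by (rule has_field_derivative_transform_within_open[of _ _ _ "{..<0}"])
        (use less Suc.prems(2) in auto)
  next
    case equal
    have "\<forall>\<^sub>F s in at_left 0. \<phi> s / s = 0"
      by (auto simp: eventually_at_filter Suc.prems(2))
    then have "((\<lambda>s. \<phi> s / s) \<longlongrightarrow> 0) (at_left 0)" by (rule tendsto_eventually)
    moreover have "((\<lambda>s. \<phi> s / s) \<longlongrightarrow> 0) (at_right 0)"
    proof (rule Lim_transform_eventually)
      show "((\<lambda>s. \<phi> s / s ^ Suc p * s ^ p) \<longlongrightarrow> 0) (at_right 0)"
        by (rule tendsto_eq_intros Suc.prems(3) refl | simp)+
      show "\<forall>\<^sub>F s in at_right 0. \<phi> s / s ^ Suc p * s ^ p = \<phi> s / s"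
        by (auto simp: eventually_at_filter)
    qed
    ultimately have "((\<lambda>s. \<phi> s / s) \<longlongrightarrow> 0) (at 0)" by (simp add: filterlim_split_at)
    then show ?thesis using equal Suc.prems(2)[of 0] by (simp add: DERIV_def \<phi>'_def)
  next
    case greater
    then show ?thesis using \<epsilon>2(2)[of t] that by (simp add: \<phi>'_def \<epsilon>_def)
  qed
  moreover have "flat p {-\<epsilon><..<\<epsilon>} \<phi>'"
    using \<epsilon>1(2) by (rule flat_subset) (auto simp: \<epsilon>_def)
  ultimately have "flat (Suc p) {-\<epsilon><..<\<epsilon>} \<phi>"
    using Suc.prems(2)[of 0] by (intro flat_SucI) auto
  moreover have "\<epsilon> > 0" using \<epsilon>1(1) \<epsilon>2(1) by (simp add: \<epsilon>_def)
  ultimately show ?case by blast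
qed

text \<open>Contracting the argument costs only smallness: with \<open>0 < u t \<le> t\<close> and
  \<open>u t \<le> 1\<close>, monotonicity gives
  \<open>u t ^ Suc p * \<psi> (u t) \<le> \<psi> t\<close>.\<close>

lemma Phi_minorant_exists:
  fixes \<psi> :: "real \<Rightarrow> real"
  assumes \<psi>: "definable_fun \<psi>" "mono \<psi>" "\<And>t. t > 0 \<Longrightarrow> \<psi> t > 0" and "M \<ge> 0"
  obtains \<phi> where "\<phi> \<in> Phi p" "definable_fun \<phi>" "\<And>t. 0 < t \<Longrightarrow> t \<le> M \<Longrightarrow> \<phi> t \<le> \<psi> t"
proof -
  \<comment> \<open>Monotonicity bounds \<open>\<psi>\<close> by \<open>\<psi> 1\<close> on
    \<open>(0, 1)\<close>, so one factor \<open>t\<close> beyond \<open>t ^ p\<close> is enough for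
    the quotient by \<open>t ^ p\<close> to tend to \<open>0\<close>.\<close>
  define \<phi>0 where "\<phi>0 t = (if 0 < t then t ^ Suc p * \<psi> t else 0)" for t
  have def_\<phi>0: "definable_fun \<phi>0"
    unfolding \<phi>0_def by (intro definable_intros definable_fun_comp[OF \<psi>(1)])
  have "((\<lambda>t. \<phi>0 t / t ^ p) \<longlongrightarrow> 0) (at_right 0)"
  proof (rule tendsto_sandwich)
    show "\<forall>\<^sub>F t in at_right 0. 0 \<le> \<phi>0 t / t ^ p"
      using \<psi>(3) by (auto simp: eventually_at_filter \<phi>0_def less_imp_le)
    have "\<phi>0 t / t ^ p \<le> t * \<psi> 1" if "0 < t" "t < 1" for t
      using that monoD[OF \<psi>(2), of t 1] by (simp add: \<phi>0_def)
    then show "\<forall>\<^sub>F t in at_right 0. \<phi>0 t / t ^ p \<le> t * \<psi> 1"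
      unfolding eventually_at_right_field by (intro exI[of _ 1]) auto
    show "((\<lambda>t. t * \<psi> 1) \<longlongrightarrow> 0) (at_right 0)"
      by (rule tendsto_eq_intros refl | simp)+
  qed auto
  moreover have "\<phi>0 t = 0" if "t \<le> 0" for t using that by (simp add: \<phi>0_def)
  ultimately obtain \<epsilon>0 where \<epsilon>0: "\<epsilon>0 > 0" "flat p {-\<epsilon>0<..<\<epsilon>0} \<phi>0"
    using definable_flat[OF def_\<phi>0] by blast
  \<comment> \<open>The bound \<open>1\<close> will yield \<open>u t \<le> t\<close> for
    \<open>t \<ge> 0\<close> and \<open>u t ^ Suc p \<le> 1\<close> for \<open>t > 0\<close>; the
    bound \<open>\<epsilon>0\<close> keeps \<open>u\<close> where \<open>\<phi>0\<close> is
    flat.\<close>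
  define \<epsilon> where "\<epsilon> = min \<epsilon>0 1"
  have \<epsilon>: "0 < \<epsilon>" "\<epsilon> \<le> 1" "\<epsilon> \<le> \<epsilon>0" using \<epsilon>0(1) by (auto simp: \<epsilon>_def)
  \<comment> \<open>This diffeomorphism onto an interval inside \<open>(-\<epsilon>0, \<epsilon>0)\<close> makes \<open>\<phi>0\<close> smooth on the whole line.\<close>
  define u where "u t = \<epsilon> * (t * (1 / sqrt (1 + t\<^sup>2)))" for t :: real
  have sq: "\<bar>t\<bar> < sqrt (1 + t\<^sup>2)" "1 \<le> sqrt (1 + t\<^sup>2)" for t :: real
    by (auto intro: real_less_rsqrt)
  have u_minus: "u (- t) = - u t" for t by (simp add: u_def)
  have u_pos: "0 < u t \<longleftrightarrow> 0 < t" for t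
  proof -
    define w where "w = 1 / sqrt (1 + t\<^sup>2)"
    have "w > 0" unfolding w_def using sq(2)[of t] by (intro divide_pos_pos) linarith+
    moreover have "u t = \<epsilon> * (t * w)" by (simp add: u_def w_def)
    ultimately show ?thesis using \<epsilon>(1) by (simp add: zero_less_mult_iff)
  qed
  have u_bound: "\<bar>u t\<bar> < \<epsilon>" for t
  proof -
    have "\<bar>t * (1 / sqrt (1 + t\<^sup>2))\<bar> < 1"
      using sq[of t] by (simp add: abs_mult divide_less_eq not_less)
    then have "\<epsilon> * \<bar>t * (1 / sqrt (1 + t\<^sup>2))\<bar> < \<epsilon> * 1"
      using \<epsilon>(1) by (rule mult_strict_left_mono)
    moreover have "\<bar>u t\<bar> = \<epsilon> * \<bar>t * (1 / sqrt (1 + t\<^sup>2))\<bar>"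
      unfolding u_def abs_mult[of \<epsilon>] using \<epsilon>(1) by (simp only: abs_of_pos)
    ultimately show ?thesis by (simp only: mult_1_right)
  qed
  have u_le: "u t \<le> t" if "0 \<le> t" for t
  proof -
    have "\<epsilon> * (1 / sqrt (1 + t\<^sup>2)) \<le> 1 * 1"
      using \<epsilon> by (intro mult_mono) (auto simp: divide_le_eq_1 add_pos_nonneg)
    then show ?thesis
      using mult_left_mono[OF _ that] by (fastforce simp: u_def mult_ac)
  qed
  have u_mono: "u s < u t" if "s < t" "0 \<le> s" for s t
  proof -
    \<comment> \<open>The square is \<open>1\<close> minus a decreasing function of non-negative
      \<open>s\<close>, which gives strict monotonicity without differentiating.\<close>
    have "(s * (1 / sqrt (1 + s\<^sup>2)))\<^sup>2 = 1 - 1 / (1 + s\<^sup>2)" for s :: real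
    proof -
      have "1 + s\<^sup>2 > 0" by (simp add: add_pos_nonneg)
      then show ?thesis by (simp add: power_mult_distrib power_divide field_simps)
    qed
    moreover have "1 / (1 + t\<^sup>2) < 1 / (1 + s\<^sup>2)"
      using that by (intro divide_strict_left_mono) (auto intro!: mult_pos_pos add_pos_nonneg power_strict_mono)
    ultimately have "(s * (1 / sqrt (1 + s\<^sup>2)))\<^sup>2 < (t * (1 / sqrt (1 + t\<^sup>2)))\<^sup>2" by simp
    then have "s * (1 / sqrt (1 + s\<^sup>2)) < t * (1 / sqrt (1 + t\<^sup>2))"
      by (rule power2_less_imp_less)
        (use that in \<open>auto intro!: mult_nonneg_nonneg divide_nonneg_nonneg add_nonneg_nonneg\<close>)
    from this \<epsilon>(1) show ?thesis unfolding u_def by (rule mult_strict_left_mono)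
  qed
  \<comment> \<open>The second summand makes the final function surjective without changing it on \<open>[-M, M]\<close>.\<close>
  define g where "g t = \<phi>0 (u t) + max 0 (t - M) ^ Suc p" for t
  \<comment> \<open>As \<open>g\<close> vanishes on the non-positive reals, this is the odd
    extension of its restriction to the positive ones.\<close>
  define \<phi> where "\<phi> t = g t + - g (- t)" for t
  have "flat p UNIV g"
    unfolding g_def
  proof (rule flat_add[OF flat_compose[OF \<epsilon>0(2)] flat_max_power[OF \<open>M \<ge> 0\<close>]])
    show "Ck p u"
      unfolding u_def by (intro Ck_mult Ck_const Ck_id Ck_inverse_sqrt)
    have "- \<epsilon>0 < u t \<and> u t < \<epsilon>0" for t using u_bound[of t] \<epsilon>(3) by linarith
    then show "range u \<subseteq> {-\<epsilon>0<..<\<epsilon>0}" by auto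
  qed (simp add: u_def)
  then have "flat p UNIV \<phi>"
    unfolding \<phi>_def by (intro flat_add flat_uminus flat_compose_uminus)
  then have smooth: "of_class_C p \<phi>" "\<forall>k\<in>{1..p}. (deriv ^^ k) \<phi> 0 = 0"
    and cont: "continuous_on UNIV \<phi>"
    using flat_imp_of_class_C[of p \<phi>] flat_imp_continuous by auto
  have \<phi>0_mono: "\<phi>0 s < \<phi>0 t" if "s < t" "0 < t" for s t
  proof (cases "0 < s")
    case True
    have "s ^ Suc p * \<psi> s < t ^ Suc p * \<psi> t"
      using True that monoD[OF \<psi>(2), of s t] \<psi>(3)[of s]
      by (intro mult_strict_mono' power_strict_mono mult_less_le_imp_less) auto
    then show ?thesis using True that by (simp add: \<phi>0_def)
  next
    case False
    then show ?thesis using that \<psi>(3)[of t] by (simp add: \<phi>0_def)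
  qed
  have g_nonpos: "g t = 0" if "t \<le> 0" for t
    using that \<open>M \<ge> 0\<close> u_pos[of t] by (auto simp: g_def \<phi>0_def max_def)
  have g_mono: "g s < g t" if "s < t" "0 < t" for s t
  proof -
    have "u s < u t"
    proof (cases "0 \<le> s")
      case False
      then have "u s \<le> 0" "0 < u t" using u_pos[of s] u_pos[of t] that by auto
      then show ?thesis by linarith
    qed (use u_mono that in auto)
    then have "\<phi>0 (u s) < \<phi>0 (u t)" using u_pos[of t] that by (intro \<phi>0_mono) auto
    moreover have "max 0 (s - M) ^ Suc p \<le> max 0 (t - M) ^ Suc p"
      using that by (intro power_mono) auto
    ultimately show ?thesis by (simp add: g_def)
  qed
  have mono: "strict_mono \<phi>"
  proof (rule strict_monoI)
    fix s t :: real assume "s < t"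
    show "\<phi> s < \<phi> t"
    proof (cases "0 < t")
      case True
      then show ?thesis
        using \<open>s < t\<close> g_mono[of s t] g_mono[of "- t" "- s"] g_nonpos[of "- s"] g_nonpos[of "- t"]
        by (cases "0 < - s") (auto simp: \<phi>_def)
    next
      case False
      then show ?thesis
        using \<open>s < t\<close> g_mono[of "- t" "- s"] g_nonpos[of s] g_nonpos[of t]
        by (auto simp: \<phi>_def)
    qed
  qed
  have odd: "\<phi> (- t) = - \<phi> t" for t by (simp add: \<phi>_def)
  \<comment> \<open>At this argument the added power is \<open>max 1 \<bar>y\<bar> ^ Suc p\<close>,
    and a base of at least \<open>1\<close> is dominated by its powers; with oddness,
    \<open>\<phi>\<close> takes values on both sides of \<open>y\<close>.\<close>
  have large: "\<bar>y\<bar> \<le> \<phi> (M + max 1 \<bar>y\<bar>)" for y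
  proof -
    let ?t = "M + max 1 \<bar>y\<bar>"
    have "\<bar>y\<bar> \<le> max 1 \<bar>y\<bar> ^ Suc p"
      using self_le_power[of "max 1 \<bar>y\<bar>" "Suc p"] by linarith
    moreover have "\<phi>0 (u ?t) \<ge> 0"
      using \<psi>(3)[of "u ?t"] unfolding \<phi>0_def by (auto intro!: mult_nonneg_nonneg)
    moreover have "\<phi> ?t = \<phi>0 (u ?t) + max 1 \<bar>y\<bar> ^ Suc p"
      using g_nonpos[of "- ?t"] \<open>M \<ge> 0\<close> by (auto simp: \<phi>_def g_def max_def)
    ultimately show ?thesis by linarith
  qed
  have "\<exists>t. \<phi> t = y" for y
  proof -
    let ?t = "M + max 1 \<bar>y\<bar>"
    have "\<phi> (- ?t) \<le> y" "y \<le> \<phi> ?t" using large[of y] odd[of ?t] by linarith+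
    moreover have "- ?t \<le> ?t" using \<open>M \<ge> 0\<close> by linarith
    ultimately show ?thesis
      using IVT'[of \<phi> "- ?t" y ?t] continuous_on_subset[OF cont] by auto
  qed
  then have "surj \<phi>" by (metis surjI)
  then have bij: "bij \<phi>" using strict_mono_imp_inj_on[OF mono] by (simp add: bij_def)
  have def_u: "definable_fun u"
    unfolding u_def by (intro definable_intros)
  have def_g: "definable_fun g"
    unfolding g_def
    by (intro definable_intros definable_fun_comp[OF def_\<phi>0] definable_fun_comp[OF def_u])
  show thesis
  proof (rule that[of \<phi>])
    show "\<phi> \<in> Phi p" using odd mono bij smooth by (simp add: Phi_def)
    show "definable_fun \<phi>"
      unfolding \<phi>_def by (intro definable_intros definable_fun_comp[OF def_g])
    fix t :: real assume t: "0 < t" "t \<le> M"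
    have u: "0 < u t" "u t \<le> t" "u t \<le> 1" using u_pos[of t] u_le[of t] u_bound[of t] \<epsilon> t by auto
    have "\<phi> t = u t ^ Suc p * \<psi> (u t)"
      using t u g_nonpos[of "- t"] by (simp add: \<phi>_def g_def \<phi>0_def)
    also have "\<dots> \<le> 1 * \<psi> t"
      using u t \<psi>(3)[of "u t"] monoD[OF \<psi>(2), of "u t" t]
      by (intro mult_mono power_le_one) auto
    finally show "\<phi> t \<le> \<psi> t" by simp
  qed
qed

end

section \<open>The metric on closed sets\<close>

text \<open>The norm is written as a distance because definability of distances is available.\<close>

definition stereo_param :: "real ^ 'n \<Rightarrow> (real ^ 'n) \<times> real" where
  "stereo_param y =
     ((4 / ((dist y 0)\<^sup>2 + 4)) *\<^sub>R y, ((dist y 0)\<^sup>2 - 4) / ((dist y 0)\<^sup>2 + 4))"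

lemma stereo_param_pos: "0 < (dist (y :: real ^ 'n) 0)\<^sup>2 + 4"
  by (simp add: add_nonneg_pos)

lemma stereo_stereo_param: "stereo (stereo_param y) = (y, -1)"
proof -
  define q where "q = (dist y 0)\<^sup>2 + 4"
  have "q > 0" unfolding q_def by (rule stereo_param_pos)
  moreover have "stereo_param y = ((4 / q) *\<^sub>R y, (q - 8) / q)"
    by (simp add: stereo_param_def q_def)
  moreover have "(q - 8) / q - 1 = - 8 / q" using \<open>q > 0\<close> by (simp add: field_simps)
  ultimately show ?thesis by (simp add: stereo_def)
qed

lemma stereo_param_mem: "stereo_param y \<in> sphere 0 1 - {north_pole}"
proof -
  define q where "q = (dist y 0)\<^sup>2 + 4"
  have "q > 0" unfolding q_def by (rule stereo_param_pos)
  have eq: "stereo_param y = ((4 / q) *\<^sub>R y, (q - 8) / q)"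
    by (simp add: stereo_param_def q_def)
  have y: "(norm y)\<^sup>2 = q - 4" by (simp add: q_def)
  have "(norm ((4 / q) *\<^sub>R y))\<^sup>2 + (norm ((q - 8) / q))\<^sup>2 = (4 / q)\<^sup>2 * (q - 4) + ((q - 8) / q)\<^sup>2"
    by (simp add: power_mult_distrib y power_divide)
  also have "\<dots> = 1" using \<open>q > 0\<close> by (simp add: field_simps power2_eq_square)
  finally have "norm (stereo_param y) = 1" by (simp add: eq norm_Pair)
  moreover have "stereo_param y \<noteq> north_pole"
    using \<open>q > 0\<close> by (auto simp: eq north_pole_def field_simps)
  ultimately show ?thesis by simp
qed

lemma stereo_param_stereo:
  assumes "z \<in> sphere 0 1 - {north_pole}"
  shows "stereo_param (fst (stereo z)) = z"
proof -
  obtain x s where z: "z = (x, s)" by (cases z)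
  have sphere: "(norm x)\<^sup>2 + s\<^sup>2 = 1"
    using assms by (simp add: z norm_Pair)
  have "s \<noteq> 1"
  proof
    assume "s = 1"
    then have "z = north_pole" using sphere by (simp add: z north_pole_def)
    then show False using assms by simp
  qed
  moreover have "s\<^sup>2 \<le> 1" using sphere by (smt (verit) zero_le_power2)
  then have "s \<le> 1" by (metis power2_le_imp_le one_power2 zero_le_one)
  ultimately have s: "s < 1" by simp
  \<comment> \<open>The projection scales the first component by \<open>c\<close>, and the
    denominator of \<open>stereo_param\<close> at the projected point becomes
    \<open>4 * c\<close>.\<close>
  define c where "c = 2 / (1 - s)"
  have "c > 0" using s by (simp add: c_def)
  have "(norm x)\<^sup>2 = (1 - s) * (1 + s)" using sphere by (simp add: algebra_simps power2_eq_square)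
  then have norm: "c\<^sup>2 * (norm x)\<^sup>2 = 2 * c * (1 + s)"
    using s by (simp add: c_def power2_eq_square)
  have s_eq: "s = 1 - 2 / c" using s by (simp add: c_def diff_divide_distrib)
  have "- 2 / (s - 1) = c"
    by (metis c_def minus_diff_eq minus_divide_left minus_divide_right)
  then have st: "fst (stereo z) = c *\<^sub>R x" by (simp add: stereo_def z)
  have "(dist (c *\<^sub>R x) 0)\<^sup>2 = c\<^sup>2 * (norm x)\<^sup>2" by (simp add: power_mult_distrib)
  also have "\<dots> = 2 * c * (1 + s)" by (rule norm)
  also have "\<dots> = 4 * c - 4" using \<open>c > 0\<close> by (simp add: s_eq field_simps)
  finally have d: "(dist (c *\<^sub>R x) 0)\<^sup>2 = 4 * c - 4" .
  show ?thesis
    unfolding st stereo_param_def d using \<open>c > 0\<close> by (simp add: z s_eq field_simps)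
qed

lemma stereo_inv_eq: "stereo_inv (y, -1) = stereo_param y"
  unfolding stereo_inv_def
proof (rule inv_into_f_eq)
  show "inj_on stereo (sphere 0 1 - {north_pole :: (real ^ 'n) \<times> real})"
    by (rule inj_on_inverseI[where g = "\<lambda>w. stereo_param (fst w)"]) (rule stereo_param_stereo)
qed (rule stereo_param_mem stereo_stereo_param)+

text \<open>The pole makes the set non-empty even for \<open>A = {}\<close>, so
  \<open>dist_K (F x) (F a)\<close> is definable as a function of all \<open>x\<close>, including
  those outside the domain.\<close>

definition pointed :: "(real ^ 'n) set \<Rightarrow> ((real ^ 'n) \<times> real) set" where
  "pointed A = stereo_param ` A \<union> {north_pole}"

lemma dist_K_eq:
  fixes A B :: "(real ^ 'n) set"
  shows "dist_K A B = dist_H (pointed A) (pointed B)"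
proof -
  have "stereo_inv ` (A \<times> {-1}) = stereo_param ` A" for A :: "(real ^ 'n) set"
    by (force simp: stereo_inv_eq)
  then show ?thesis by (simp add: dist_K_def pointed_def)
qed

lemma pointed_nonempty: "pointed A \<noteq> {}"
  by (simp add: pointed_def)

lemma bounded_pointed: "bounded (pointed A)"
proof (rule bounded_subset)
  have "north_pole \<in> sphere 0 1" by (simp add: north_pole_def norm_Pair)
  then show "pointed A \<subseteq> sphere 0 1"
    using stereo_param_mem unfolding pointed_def by blast
qed simp

lemma infdist_le_SUP:
  assumes "x \<in> A" "bounded A" "B \<noteq> {}"
  shows "infdist x B \<le> (SUP x\<in>A. infdist x B)"
  by (rule cSUP_upper[OF assms(1) bdd_above_infdist[OF assms(2,3)]])

lemma infdist_le_dist_K: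
  shows "x \<in> pointed A \<Longrightarrow> infdist x (pointed B) \<le> dist_K A B"
    and "x \<in> pointed B \<Longrightarrow> infdist x (pointed A) \<le> dist_K A B"
  using infdist_le_SUP[OF _ bounded_pointed pointed_nonempty]
  by (fastforce simp: dist_K_eq dist_H_def intro: max.coboundedI1 max.coboundedI2)+

lemma dist_K_nonneg: "0 \<le> dist_K A B"
  using infdist_le_dist_K(1)[of north_pole A B] infdist_nonneg[of north_pole "pointed B"]
  by (simp add: pointed_def)

lemma infdist_lessE:
  assumes "infdist x A < e" "A \<noteq> {}"
  obtains a where "a \<in> A" "dist x a < e"
proof -
  have "bdd_below (dist x ` A)" by (auto intro: bdd_belowI[of _ 0])
  then show thesis using assms that by (auto simp: infdist_notempty cINF_less_iff)
qed

text \<open>The chart is continuous at \<open>stereo_param y\<close>, and \<open>\<delta>\<close> is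
  at most the distance to the pole, so a nearby point of \<open>pointed A\<close> comes from
  \<open>A\<close>. As \<open>\<delta>\<close> is independent of \<open>A\<close>, it can be used
  along a sequence of sets.\<close>

lemma near_of_infdist_stereo_param:
  fixes y :: "real ^ 'n"
  assumes "e > 0"
  obtains \<delta> where "\<delta> > 0"
    "\<And>A. infdist (stereo_param y) (pointed A) < \<delta> \<Longrightarrow> \<exists>z\<in>A. dist y z < e"
proof -
  have "snd (stereo_param y) - 1 \<noteq> 0"
    using stereo_param_pos[of y] by (simp add: stereo_param_def field_simps)
  then have "isCont (\<lambda>w. fst (stereo w)) (stereo_param y)"
    unfolding stereo_def fst_conv by (intro continuous_intros) auto
  then obtain \<delta>0 where \<delta>0: "\<delta>0 > 0"
    "\<And>w. dist w (stereo_param y) < \<delta>0 \<Longrightarrow> dist (fst (stereo w)) (fst (stereo (stereo_param y))) < e"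
    using assms unfolding continuous_at_eps_delta by meson
  define \<delta> where "\<delta> = min \<delta>0 (dist (stereo_param y) north_pole)"
  show thesis
  proof (rule that)
    show "\<delta> > 0" using \<delta>0(1) stereo_param_mem[of y] by (simp add: \<delta>_def)
    fix A assume "infdist (stereo_param y) (pointed A) < \<delta>"
    then obtain w where w: "w \<in> pointed A" "dist (stereo_param y) w < \<delta>"
      using pointed_nonempty by (rule infdist_lessE)
    then have "w \<noteq> north_pole" by (auto simp: \<delta>_def)
    then obtain z where z: "z \<in> A" "w = stereo_param z" using w(1) by (auto simp: pointed_def)
    have "dist (fst (stereo w)) (fst (stereo (stereo_param y))) < e"
      using w(2) by (intro \<delta>0(2)) (simp add: \<delta>_def dist_commute)
    then show "\<exists>z\<in>A. dist y z < e"
      using z by (auto simp: stereo_stereo_param dist_commute)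
  qed
qed

lemma continuous_stereo_param: "isCont stereo_param (y :: real ^ 'n)"
proof -
  have "(dist y 0)\<^sup>2 + 4 \<noteq> 0" using stereo_param_pos[of y] by simp
  then show ?thesis unfolding stereo_param_def by (intro continuous_intros) auto
qed

lemma infdist_tendsto_zeroE:
  assumes "(\<lambda>k. infdist y (A k)) \<longlonglongrightarrow> 0" "\<And>k. A k \<noteq> {}"
  obtains y' where "\<And>k :: nat. y' k \<in> A k" "y' \<longlonglongrightarrow> y"
proof -
  have "\<exists>z. z \<in> A k \<and> dist y z < infdist y (A k) + 1 / real (Suc k)" for k
    using infdist_lessE[of y "A k" "infdist y (A k) + 1 / real (Suc k)"] assms(2)[of k]
    by (metis less_add_same_cancel1 of_nat_0_less_iff zero_less_Suc zero_less_divide_1_iff)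
  then obtain y' where y': "\<And>k. y' k \<in> A k" "\<And>k. dist y (y' k) < infdist y (A k) + 1 / real (Suc k)"
    by metis
  have lim: "(\<lambda>k. infdist y (A k) + 1 / real (Suc k)) \<longlonglongrightarrow> 0"
    using tendsto_add[OF assms(1) LIMSEQ_inverse_real_of_nat] by (simp add: inverse_eq_divide)
  have "(\<lambda>k. dist (y' k) y) \<longlonglongrightarrow> 0"
    by (rule tendsto_sandwich[OF _ _ tendsto_const lim])
      (use y'(2) in \<open>auto simp: dist_commute less_imp_le\<close>)
  then have "y' \<longlonglongrightarrow> y" by (rule tendsto_dist_iff[THEN iffD2])
  with y'(1) show thesis by (rule that)
qed

section \<open>Semicontinuity along sequences\<close>

text \<open>\<open>mlimsup\<close> ignores the value at \<open>x\<close> itself. If the sequence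
  hits \<open>x\<close> infinitely often, closedness of \<open>F x\<close> gives the claim;
  otherwise a tail avoids \<open>x\<close>, which also shows that \<open>x\<close> is not isolated
  in the domain.\<close>

lemma outer_semicontinuous_mem:
  fixes F :: "'a::metric_space \<Rightarrow> 'b::metric_space set"
  assumes F: "outer_semicontinuous F" and "closed (F x)"
    and X: "\<And>k. X k \<in> mdom F" "X \<longlonglongrightarrow> x" "x \<in> mdom F"
    and y: "(\<lambda>k. infdist y (F (X k))) \<longlonglongrightarrow> 0"
  shows "y \<in> F x"
proof (cases "\<exists>\<^sub>F k in sequentially. X k = x")
  case True
  have "infdist y (F x) < e" if "e > 0" for e
  proof -
    have "\<forall>\<^sub>F k in sequentially. infdist y (F (X k)) < e"
      using y \<open>e > 0\<close> by (rule order_tendstoD)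
    from frequently_eventually_conj[OF True this]
    have "\<exists>\<^sub>F k in sequentially. X k = x \<and> infdist y (F (X k)) < e"
      by (simp add: conj_commute)
    then show ?thesis using frequently_ex by fastforce
  qed
  then have "infdist y (F x) = 0" using infdist_nonneg[of y "F x"] by (meson less_irrefl not_le order.antisym)
  then show ?thesis using \<open>closed (F x)\<close> \<open>x \<in> mdom F\<close> by (simp add: in_closed_iff_infdist_zero mdom_def)
next
  case False
  then obtain N where N: "\<And>k. k \<ge> N \<Longrightarrow> X k \<noteq> x"
    by (auto simp: not_frequently eventually_sequentially)
  define X' where "X' k = X (k + N)" for k
  have X': "\<And>k. X' k \<in> mdom F - {x}" "X' \<longlonglongrightarrow> x"
    using X(1) N LIMSEQ_ignore_initial_segment[OF X(2), of N] by (auto simp: X'_def[abs_def])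
  have "(\<lambda>k. infdist y (F (X' k))) \<longlonglongrightarrow> 0"
    using LIMSEQ_ignore_initial_segment[OF y, of N] by (simp add: X'_def)
  moreover have "F (X' k) \<noteq> {}" for k using X'(1) by (auto simp: mdom_def)
  ultimately obtain y' where "\<And>k. y' k \<in> F (X' k)" "y' \<longlonglongrightarrow> y"
    using infdist_tendsto_zeroE[of y "\<lambda>k. F (X' k)"] by blast
  then have "y \<in> mlimsup F x"
    unfolding mlimsup_def using X' by blast
  moreover have "x \<in> closure (mdom F - {x})"
    unfolding closure_sequential using X' by blast
  ultimately show ?thesis using F X(3) unfolding outer_semicontinuous_def by blast
qed

text \<open>Otherwise the distance stays at least some \<open>e > 0\<close> along a subsequence.
  That subsequence avoids \<open>x\<close>, because \<open>y \<in> F x\<close> makes the distance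
  there \<open>0\<close>, so inner semicontinuity applies to it.\<close>

lemma inner_semicontinuous_infdist:
  fixes F :: "'a::metric_space \<Rightarrow> 'b::metric_space set"
  assumes F: "inner_semicontinuous F"
    and X: "\<And>k. X k \<in> mdom F" "X \<longlonglongrightarrow> x" "x \<in> mdom F"
    and y: "y \<in> F x"
  shows "(\<lambda>k. infdist y (F (X k))) \<longlonglongrightarrow> 0"
proof (rule ccontr)
  assume "\<not> (\<lambda>k. infdist y (F (X k))) \<longlonglongrightarrow> 0"
  then obtain e where "e > 0" "\<not> (\<forall>\<^sub>F k in sequentially. infdist y (F (X k)) < e)"
    unfolding tendsto_iff by (auto simp: dist_real_def infdist_nonneg)
  then have "infinite {k. e \<le> infdist y (F (X k))}"
    by (simp add: not_eventually not_less flip: cofinite_eq_sequentially INFM_iff_infinite)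
  then obtain r where r: "strict_mono r" "\<And>k :: nat. e \<le> infdist y (F (X (r k)))"
    using infinite_enumerate by (metis (mono_tags, lifting) mem_Collect_eq)
  have "X (r k) \<noteq> x" for k using r(2)[of k] y \<open>e > 0\<close> by auto
  then have X': "\<And>k. (X \<circ> r) k \<in> mdom F - {x}" "(X \<circ> r) \<longlonglongrightarrow> x"
    using X(1) LIMSEQ_subseq_LIMSEQ[OF X(2) r(1)] by auto
  then have "x \<in> closure (mdom F - {x})" unfolding closure_sequential by blast
  then have "y \<in> mliminf F x" using F X(3) y unfolding inner_semicontinuous_def by blast
  then obtain y' where y': "\<And>k. y' k \<in> F ((X \<circ> r) k)" "y' \<longlonglongrightarrow> y"
    unfolding mliminf_def using X' by blast
  have "\<forall>\<^sub>F k in sequentially. dist (y' k) y < e"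
    using y'(2) \<open>e > 0\<close> by (rule tendstoD)
  then obtain k where "dist (y' k) y < e" by (auto simp: eventually_sequentially)
  moreover have "infdist y (F (X (r k))) \<le> dist y (y' k)" using y'(1)[of k] by (auto intro: infdist_le)
  ultimately show False using r(2)[of k] by (simp add: dist_commute)
qed

text \<open>One half of the Hausdorff distance: points of \<open>B\<close> are approximated by
  points of \<open>F (X k)\<close>, and \<open>outer_semicontinuous_mem\<close> takes the
  limit.\<close>

lemma outer_semicontinuous_subset:
  fixes F :: "'a::metric_space \<Rightarrow> (real ^ 'n) set"
  assumes F: "outer_semicontinuous F" "closed (F x)"
    and X: "\<And>k. X k \<in> mdom F" "X \<longlonglongrightarrow> x" "x \<in> mdom F"
    and dist: "(\<lambda>k. dist_K (F (X k)) B) \<longlonglongrightarrow> 0"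
  shows "B \<subseteq> F x"
proof
  fix y assume "y \<in> B"
  have "(\<lambda>k. infdist y (F (X k))) \<longlonglongrightarrow> 0"
  proof (rule tendstoI)
    fix e :: real assume "e > 0"
    then obtain \<delta> where \<delta>: "\<delta> > 0"
      "\<And>A. infdist (stereo_param y) (pointed A) < \<delta> \<Longrightarrow> \<exists>z\<in>A. dist y z < e"
      using near_of_infdist_stereo_param by blast
    have "\<forall>\<^sub>F k in sequentially. dist_K (F (X k)) B < \<delta>"
      using dist \<delta>(1) by (rule order_tendstoD)
    then show "\<forall>\<^sub>F k in sequentially. dist (infdist y (F (X k))) 0 < e"
    proof eventually_elim
      case (elim k)
      have "infdist (stereo_param y) (pointed (F (X k))) < \<delta>"
        using infdist_le_dist_K(2)[of "stereo_param y" B "F (X k)"] elim \<open>y \<in> B\<close>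
        by (simp add: pointed_def)
      then obtain z where "z \<in> F (X k)" "dist y z < e" using \<delta>(2) by blast
      then show ?case using infdist_le[of z "F (X k)" y] by (simp add: infdist_nonneg dist_real_def)
    qed
  qed
  with F X show "y \<in> F x" by (rule outer_semicontinuous_mem)
qed

text \<open>The other half of the Hausdorff distance: a point of \<open>F x\<close> is a limit of
  points of \<open>F (X k)\<close>, whose images on the sphere approach
  \<open>pointed B\<close>.\<close>

lemma inner_semicontinuous_subset:
  fixes F :: "'a::metric_space \<Rightarrow> (real ^ 'n) set"
  assumes F: "inner_semicontinuous F"
    and X: "\<And>k. X k \<in> mdom F" "X \<longlonglongrightarrow> x" "x \<in> mdom F"
    and B: "closed B" and dist: "(\<lambda>k. dist_K (F (X k)) B) \<longlonglongrightarrow> 0"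
  shows "F x \<subseteq> B"
proof
  fix y assume "y \<in> F x"
  with F X have "(\<lambda>k. infdist y (F (X k))) \<longlonglongrightarrow> 0" by (rule inner_semicontinuous_infdist)
  then obtain y' where y': "\<And>k. y' k \<in> F (X k)" "y' \<longlonglongrightarrow> y"
    using infdist_tendsto_zeroE[of y "\<lambda>k. F (X k)"] X(1) by (auto simp: mdom_def)
  have "(\<lambda>k. infdist (stereo_param (y' k)) (pointed B)) \<longlonglongrightarrow> infdist (stereo_param y) (pointed B)"
    by (intro tendsto_infdist isCont_tendsto_compose[OF continuous_stereo_param] y')
  moreover have "infdist (stereo_param (y' k)) (pointed B) \<le> dist_K (F (X k)) B" for k
    by (rule infdist_le_dist_K(1)) (use y'(1) in \<open>simp add: pointed_def\<close>)
  then have "(\<lambda>k. infdist (stereo_param (y' k)) (pointed B)) \<longlonglongrightarrow> 0"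
    by (intro tendsto_sandwich[OF _ _ tendsto_const dist]) (auto simp: infdist_nonneg)
  ultimately have zero: "infdist (stereo_param y) (pointed B) = 0" using LIMSEQ_unique by blast
  have "\<exists>z\<in>B. dist z y < e" if e: "e > 0" for e
  proof -
    obtain \<delta> where "\<delta> > 0"
      "\<And>A. infdist (stereo_param y) (pointed A) < \<delta> \<Longrightarrow> \<exists>z\<in>A. dist y z < e"
      using near_of_infdist_stereo_param[OF e] by blast
    then show ?thesis using zero by (simp add: dist_commute)
  qed
  then show "y \<in> B" using closed_approachable[OF B, of y] by blast
qed

section \<open>Lojasiewicz inequalities\<close>

text \<open>In place of continuity of \<open>g\<close>, the hypothesis \<open>zeros\<close> controls
  limits of sequences along which \<open>g\<close> tends to \<open>0\<close>; compactness makes a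
  sequence of counterexamples converge.\<close>

lemma positive_lower_bound_on_compact:
  fixes f g :: "'a::metric_space \<Rightarrow> real"
  assumes K: "compact K" and f: "continuous_on K f" and "t > 0"
    and zeros: "\<And>X x. (\<And>k. X k \<in> K) \<Longrightarrow> X \<longlonglongrightarrow> x \<Longrightarrow> x \<in> K \<Longrightarrow> (\<lambda>k. g (X k)) \<longlonglongrightarrow> 0 \<Longrightarrow> f x \<le> 0"
    and g: "\<And>x. x \<in> K \<Longrightarrow> 0 \<le> g x"
  shows "\<exists>c>0. \<forall>x\<in>K. t \<le> f x \<longrightarrow> c \<le> g x"
proof (rule ccontr)
  assume *: "\<not> ?thesis"
  have "\<exists>x. x \<in> K \<and> t \<le> f x \<and> g x < 1 / Suc k" for k
    using * by (metis not_le of_nat_0_less_iff zero_less_Suc zero_less_divide_1_iff)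
  then obtain X where X: "\<And>k. X k \<in> K" "\<And>k. t \<le> f (X k)" "\<And>k. g (X k) < 1 / Suc k"
    by metis
  obtain x r where x: "x \<in> K" "strict_mono r" "(X \<circ> r) \<longlonglongrightarrow> x"
    using K X(1) unfolding compact_eq_seq_compact_metric seq_compact_def by metis
  have "(\<lambda>k. g (X k)) \<longlonglongrightarrow> 0"
  proof (rule tendsto_sandwich[OF _ _ tendsto_const])
    show "(\<lambda>k. 1 / real (Suc k)) \<longlonglongrightarrow> 0"
      using LIMSEQ_inverse_real_of_nat by (simp add: inverse_eq_divide)
  qed (use X g in \<open>auto intro!: always_eventually simp: less_imp_le\<close>)
  from LIMSEQ_subseq_LIMSEQ[OF this x(2)] have "(\<lambda>k. g ((X \<circ> r) k)) \<longlonglongrightarrow> 0"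
    by (simp add: o_def)
  then have "f x \<le> 0" using zeros[of "X \<circ> r" x] X(1) x by simp
  moreover have "(\<lambda>k. f ((X \<circ> r) k)) \<longlonglongrightarrow> f x"
    using continuous_on_tendsto_compose[OF f x(3,1)] X(1) by simp
  then have "t \<le> f x" using X(2) by (intro LIMSEQ_le_const) auto
  ultimately show False using \<open>t > 0\<close> by simp
qed

context o_minimal_structure
begin

lemma definable_Lojasiewicz:
  fixes f g :: "'a::{real_coded, metric_space} \<Rightarrow> real"
  assumes K: "definable (\<lambda>x. x \<in> K)" "compact K"
    and f: "definable_fun f" "continuous_on K f"
    and g: "definable_fun g" "\<And>x. x \<in> K \<Longrightarrow> 0 \<le> g x"
    and zeros: "\<And>X x. (\<And>k. X k \<in> K) \<Longrightarrow> X \<longlonglongrightarrow> x \<Longrightarrow> x \<in> K \<Longrightarrow> (\<lambda>k. g (X k)) \<longlonglongrightarrow> 0 \<Longrightarrow> f x \<le> 0"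
  obtains \<phi> where "\<phi> \<in> Phi p" "definable_fun \<phi>" "\<And>x. x \<in> K \<Longrightarrow> \<phi> (f x) \<le> g x"
proof -
  \<comment> \<open>The element \<open>1\<close> provides a value when no \<open>x\<close> in
    \<open>K\<close> has \<open>t \<le> f x\<close>. Adding it can only lower the infimum, so
    \<open>\<psi> (f x) \<le> g x\<close> survives, and positivity is preserved.\<close>
  define A where "A t = {s. s = 1 \<or> (\<exists>x\<in>K. t \<le> f x \<and> s = g x)}" for t
  define \<psi> where "\<psi> t = Inf (A t)" for t
  have ne: "A t \<noteq> {}" for t by (auto simp: A_def)
  have bdd: "bdd_below (A t)" for t
    using g(2) by (intro bdd_belowI[of _ 0]) (auto simp: A_def)
  have "definable (\<lambda>z :: real \<times> real. snd z = 1 \<or> (\<exists>x\<in>K. fst z \<le> f x \<and> snd z = g x))"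
    by (intro definable_intros definable_comp[OF K(1)] definable_fun_comp[OF f(1)]
        definable_fun_comp[OF g(1)])
  then have "definable_fun \<psi>"
    unfolding \<psi>_def by (intro definable_fun_Inf ne bdd) (simp add: A_def)
  moreover have "mono \<psi>"
    unfolding \<psi>_def by (intro monoI cInf_superset_mono ne bdd) (force simp: A_def)
  moreover have "\<psi> t > 0" if pos: "t > 0" for t
  proof -
    have "\<exists>c>0. \<forall>x\<in>K. t \<le> f x \<longrightarrow> c \<le> g x"
      by (rule positive_lower_bound_on_compact[OF K(2) f(2) pos]) (use zeros g(2) in blast)+
    then obtain c where "c > 0" "\<And>x. x \<in> K \<Longrightarrow> t \<le> f x \<Longrightarrow> c \<le> g x" by blast
    then have "min 1 c \<le> \<psi> t"
      unfolding \<psi>_def by (intro cInf_greatest ne) (auto simp: A_def min_le_iff_disj)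
    then show ?thesis using \<open>c > 0\<close> by linarith
  qed
  \<comment> \<open>On \<open>K\<close> the values of \<open>f\<close> are at most \<open>M\<close>,
    so the minorant may exceed \<open>\<psi>\<close> beyond \<open>M\<close>.\<close>
  moreover obtain M where M: "\<And>x. x \<in> K \<Longrightarrow> f x \<le> M" "M \<ge> 0"
  proof -
    have "bdd_above (f ` K)"
      using compact_continuous_image[OF f(2) K(2)] by (simp add: bounded_imp_bdd_above compact_imp_bounded)
    then obtain M where "\<And>x. x \<in> K \<Longrightarrow> f x \<le> M" unfolding bdd_above_def by blast
    then show thesis using that[of "max 0 M"] by (auto simp: le_max_iff_disj)
  qed
  ultimately obtain \<phi> where \<phi>: "\<phi> \<in> Phi p" "definable_fun \<phi>"
    "\<And>t. 0 < t \<Longrightarrow> t \<le> M \<Longrightarrow> \<phi> t \<le> \<psi> t"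
    using Phi_minorant_exists by metis
  show thesis
  proof (rule that[OF \<phi>(1,2)])
    fix x assume x: "x \<in> K"
    show "\<phi> (f x) \<le> g x"
    proof (cases "0 < f x")
      case True
      then have "\<phi> (f x) \<le> \<psi> (f x)" using \<phi>(3) M(1)[OF x] by blast
      also have "\<dots> \<le> g x"
        unfolding \<psi>_def by (intro cInf_lower bdd) (use x in \<open>auto simp: A_def\<close>)
      finally show ?thesis .
    next
      case False
      \<comment> \<open>At non-positive arguments \<open>\<phi>\<close> is at most
        \<open>\<phi> 0\<close>, which is \<open>0\<close> by oddness.\<close>
      have odd: "\<phi> (- 0) = - \<phi> 0" and "strict_mono \<phi>" using \<phi>(1) unfolding Phi_def by blast+
      then have "\<phi> (f x) \<le> \<phi> 0" using False by (simp only: strict_mono_less_eq not_less)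
      also have "\<dots> = 0" using odd by simp
      finally show ?thesis using g(2)[OF x] by simp
    qed
  qed
qed

section \<open>Definability of the metric on closed sets\<close>

lemma definable_fun_stereo_param [definable_intros]:
  fixes f :: "'e::real_coded \<Rightarrow> real ^ 'n"
  assumes "definable_fun f"
  shows "definable_fun (\<lambda>e. stereo_param (f e))"
  unfolding stereo_param_def
proof (rule definable_fun_Pair[OF definable_fun_vec])
  show "definable_fun (\<lambda>e. ((4 / ((dist (f e) 0)\<^sup>2 + 4)) *\<^sub>R f e) $ i)" for i
    unfolding vector_scaleR_component real_scaleR_def by (intro definable_intros assms)
  show "definable_fun (\<lambda>e. ((dist (f e) 0)\<^sup>2 - 4) / ((dist (f e) 0)\<^sup>2 + 4))"
    by (intro definable_intros assms)
qed

lemma definable_multifunction_definable: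
  assumes "definable_multifunction S F"
  shows "definable (\<lambda>z. snd z \<in> F (fst z))"
proof -
  have "enc ` {z. snd z \<in> F (fst z)} = {coords x @ coords y | x y. y \<in> F x}"
    (is "?L = ?R")
  proof (intro equalityI subsetI)
    fix xs assume "xs \<in> ?R"
    then obtain x y where "xs = enc (x, y)" "y \<in> F x" by (auto simp: enc_pair enc_eq_coords)
    then show "xs \<in> ?L" by simp
  qed (auto simp: enc_prod_def enc_eq_coords)
  then show ?thesis
    using assms by (simp add: definable_multifunction_def definable_def edim_prod_def edim_vec_def)
qed

lemma definable_real_fun_iff: "definable_real_fun S \<phi> \<longleftrightarrow> definable_fun \<phi>"
proof -
  have "enc ` {z. snd z = \<phi> (fst z)} = {[t, \<phi> t] | t. True}" (is "?L = ?R")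
  proof (intro equalityI subsetI)
    fix xs assume "xs \<in> ?R"
    then obtain t where "xs = enc (t, \<phi> t)" by (auto simp: enc_pair enc_real_def)
    then show "xs \<in> ?L" by simp
  qed (auto simp: enc_prod_def enc_real_def)
  then show ?thesis
    by (simp add: definable_real_fun_def definable_fun_def definable_def edim_prod_def edim_real_def
        numeral_2_eq_2)
qed

lemma definable_pointed:
  assumes "definable (\<lambda>z. snd z \<in> F (fst z))" "definable_fun h"
  shows "definable (\<lambda>z. snd z \<in> pointed (F (h (fst z))))"
proof -
  have "definable (\<lambda>z. (\<exists>y\<in>F (h (fst z)). snd z = stereo_param y) \<or> snd z = north_pole)"
    by (intro definable_intros definable_comp2[OF assms(1)] definable_fun_comp[OF assms(2)])
  then show ?thesis by (simp add: pointed_def image_iff disj_commute)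
qed

lemma definable_fun_dist_K:
  assumes "definable (\<lambda>z. snd z \<in> F (fst z))"
  shows "definable_fun (\<lambda>x. dist_K (F x) (F a))"
  unfolding dist_K_eq
  by (intro definable_fun_dist_H pointed_nonempty bounded_pointed definable_intros
      definable_pointed[OF assms definable_fun_id] definable_pointed[OF assms definable_fun_const])

text \<open>The three inequalities differ only in \<open>Z\<close>. The point \<open>a\<close> makes
  \<open>Z\<close> non-empty, so that \<open>infdist\<close> is a true infimum, and
  \<open>zeros\<close> is what semicontinuity contributes.\<close>

lemma dist_K_lower_bound:
  fixes F :: "real ^ 'm \<Rightarrow> (real ^ 'n) set"
  assumes F: "definable (\<lambda>z. snd z \<in> F (fst z))"
    and K: "compact K" "definable (\<lambda>x. x \<in> K)"
    and Z: "definable (\<lambda>x. x \<in> Z)" "a \<in> Z"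
    and zeros: "\<And>X x. (\<And>k. X k \<in> K) \<Longrightarrow> X \<longlonglongrightarrow> x \<Longrightarrow> x \<in> K \<Longrightarrow>
        (\<lambda>k. dist_K (F (X k)) (F a)) \<longlonglongrightarrow> 0 \<Longrightarrow> x \<in> Z"
  shows "\<exists>\<phi>\<in>Phi p. definable_real_fun S \<phi> \<and> (\<forall>x\<in>K. dist_K (F x) (F a) \<ge> \<phi> (infdist x Z))"
proof -
  have "definable_fun (\<lambda>x. infdist x Z)"
    using Z by (intro definable_fun_infdist definable_intros definable_comp[OF Z(1)]) auto
  moreover have "continuous_on K (\<lambda>x. infdist x Z)" by (intro continuous_intros)
  moreover have "infdist x Z \<le> 0"
    if "\<And>k. X k \<in> K" "X \<longlonglongrightarrow> x" "x \<in> K" "(\<lambda>k. dist_K (F (X k)) (F a)) \<longlonglongrightarrow> 0" for X x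
    using zeros[OF that] by simp
  ultimately obtain \<phi> where "\<phi> \<in> Phi p" "definable_fun \<phi>"
    "\<And>x. x \<in> K \<Longrightarrow> \<phi> (infdist x Z) \<le> dist_K (F x) (F a)"
    using definable_Lojasiewicz[OF K(2,1) _ _ definable_fun_dist_K[OF F] dist_K_nonneg] by blast
  then show ?thesis by (auto simp: definable_real_fun_iff)
qed

end

theorem theorem5p24:
  fixes S :: "nat \<Rightarrow> real list set set"
    and p :: nat
    and F :: "real ^ 'm \<Rightarrow> (real ^ 'n) set"
    and a :: "real ^ 'm"
    and K :: "(real ^ 'm) set"
  assumes "o_minimal_structure S"
    and "p \<ge> 1"
    and "definable_multifunction S F"
    and "\<And>x. closed (F x)"
    and "a \<in> mdom F"
    and "compact K" and "definable_set S K" and "a \<in> interior K"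
    and "K \<subseteq> mdom F"
  shows
    "(outer_semicontinuous F \<longrightarrow>
       (\<exists>\<phi>\<in>Phi p. definable_real_fun S \<phi> \<and>
         (\<forall>x\<in>K. dist_K (F x) (F a) \<ge> \<phi> (infdist x (lower_preimage F (F a)))))) \<and>
     (inner_semicontinuous F \<longrightarrow>
       (\<exists>\<phi>\<in>Phi p. definable_real_fun S \<phi> \<and>
         (\<forall>x\<in>K. dist_K (F x) (F a) \<ge> \<phi> (infdist x (upper_preimage F (F a)))))) \<and>
     (continuous_multifunction F \<longrightarrow>
       (\<exists>\<phi>\<in>Phi p. definable_real_fun S \<phi> \<and>
         (\<forall>x\<in>K. dist_K (F x) (F a) \<ge> \<phi> (infdist x (point_preimage F (F a))))))"
proof -
  interpret o_minimal_structure S by fact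
  have F: "definable (\<lambda>z. snd z \<in> F (fst z))"
    using assms(3) by (rule definable_multifunction_definable)
  note memF = definable_comp2[OF F]
  have K: "definable (\<lambda>x. x \<in> K)"
    using assms(7) by (simp add: definable_set_def definable_def enc_eq_coords edim_vec_def)
  note bound = dist_K_lower_bound[OF F \<open>compact K\<close> K, where a = a and p = p]
  have sub: "definable (\<lambda>x. \<forall>y. y \<in> F a \<longrightarrow> y \<in> F x)" "definable (\<lambda>x. \<forall>y. y \<in> F x \<longrightarrow> y \<in> F a)"
    "definable (\<lambda>x. \<exists>y. y \<in> F x)"
    by (intro definable_intros memF)+
  \<comment> \<open>The inclusion \<open>K \<subseteq> mdom F\<close> puts both the sequence and its
    limit in the domain, where semicontinuity applies.\<close>
  have osc_subset: "F a \<subseteq> F x"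
    if "outer_semicontinuous F" "\<And>k. X k \<in> K" "X \<longlonglongrightarrow> x" "x \<in> K"
      "(\<lambda>k. dist_K (F (X k)) (F a)) \<longlonglongrightarrow> 0" for X x
    by (rule outer_semicontinuous_subset[OF that(1) assms(4) _ that(3) _ that(5)])
      (use that(2,4) \<open>K \<subseteq> mdom F\<close> in auto)
  have isc_subset: "F x \<subseteq> F a"
    if "inner_semicontinuous F" "\<And>k. X k \<in> K" "X \<longlonglongrightarrow> x" "x \<in> K"
      "(\<lambda>k. dist_K (F (X k)) (F a)) \<longlonglongrightarrow> 0" for X x
    by (rule inner_semicontinuous_subset[OF that(1) _ that(3) _ assms(4) that(5)])
      (use that(2,4) \<open>K \<subseteq> mdom F\<close> in auto)
  show ?thesis
  proof (intro conjI impI)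
    assume osc: "outer_semicontinuous F"
    show "\<exists>\<phi>\<in>Phi p. definable_real_fun S \<phi> \<and>
         (\<forall>x\<in>K. dist_K (F x) (F a) \<ge> \<phi> (infdist x (lower_preimage F (F a))))"
    proof (rule bound)
      show "definable (\<lambda>x. x \<in> lower_preimage F (F a))"
        using sub(1) by (simp add: lower_preimage_def subset_iff)
    qed (use osc_subset[OF osc] in \<open>auto simp: lower_preimage_def\<close>)
  next
    assume isc: "inner_semicontinuous F"
    show "\<exists>\<phi>\<in>Phi p. definable_real_fun S \<phi> \<and>
         (\<forall>x\<in>K. dist_K (F x) (F a) \<ge> \<phi> (infdist x (upper_preimage F (F a))))"
    proof (rule bound)
      show "definable (\<lambda>x. x \<in> upper_preimage F (F a))"
        using definable_conj[OF sub(3,2)]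
        by (simp add: upper_preimage_def mdom_def subset_iff ex_in_conv)
    qed (use isc_subset[OF isc] \<open>a \<in> mdom F\<close> \<open>K \<subseteq> mdom F\<close> in \<open>auto simp: upper_preimage_def\<close>)
  next
    assume "continuous_multifunction F"
    \<comment> \<open>Equality of \<open>F x\<close> and \<open>F a\<close> splits into the two
      inclusions treated before, one from each kind of semicontinuity.\<close>
    then have osc: "outer_semicontinuous F" and isc: "inner_semicontinuous F"
      unfolding continuous_multifunction_def outer_semicontinuous_def inner_semicontinuous_def
      by auto
    show "\<exists>\<phi>\<in>Phi p. definable_real_fun S \<phi> \<and>
         (\<forall>x\<in>K. dist_K (F x) (F a) \<ge> \<phi> (infdist x (point_preimage F (F a))))"
    proof (rule bound)
      show "definable (\<lambda>x. x \<in> point_preimage F (F a))"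
        using definable_conj[OF sub(2,1)]
        by (simp add: point_preimage_def set_eq_subset subset_iff)
      fix X x
      assume "\<And>k. X k \<in> K" "X \<longlonglongrightarrow> x" "x \<in> K" "(\<lambda>k. dist_K (F (X k)) (F a)) \<longlonglongrightarrow> 0"
      then show "x \<in> point_preimage F (F a)"
        using osc_subset[OF osc, of X x] isc_subset[OF isc, of X x] by (simp add: point_preimage_def)
    qed (simp add: point_preimage_def)
  qed
qed

end
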